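(* Let $S$ be a cancellative and right amenable monoid, $G=S^{-1}S$ its group of left fractions, and $\rho$ a right $S$-action on a compact (Hausdorff) space $K$ by continuous self-maps. Let $\rho^*$, a right $G$-action on the compact space $K^*$, be the (left) Ore colocalization of $\rho$. Then $h_{\mathrm{top}}(\rho)=h_{\mathrm{top}}(\rho^* )$.
   Context: A cancellative monoid $S$ is right amenable if it admits a right F{\o}lner net, i.e. a net $\{F_i\}_{i\in I}$ of non-empty finite subsets of $S$ such that $\lim_{i\in I}|F_is\setminus F_i|/|F_i|=0$ for every $s\in S$. Such an $S$ satisfies the left Ore condition ($Ss\cap St\ne\emptyset$ for all $s,t\in S$) and so embeds in its group of left fractions $G=S^{-1}S$, in which every element has the form $s^{-1}t$ with $s,t\in S$; $G$ is amenable. A right $S$-action $\rho$ on a compact space $K$ is a family of continuous self-maps $\rho_s$ with $\rho_1=\mathrm{id}_K$, $\rho_{st}=\rho_t\circ\rho_s$ (similarly for $G$). Ore colocalization: the surjective core of $\rho$ is the closed $S$-invariant subspace $\bar K=E(\rho)=\bigcap_{t\in S}\rho_t(K)$; let $\bar\rho_s=\rho_s|_{\bar K}\colon\bar K\to\bar K$. Preorder $G$ by $g_1\le_S g_2$ iff $g_2^{-1}g_1\in S$; this is directed. Let $K^*$ be the inverse limit of the inverse system indexed by $(G,\le_S)$ with $K_g=\bar K$ for all $g\in G$ and transition maps $\bar\rho_s\colon K_g\to K_{gs}$ ($g\in G$, $s\in S$), and let $\pi_g\colon K^*\to K_g=\bar K$ be the canonical maps. Then $\rho^*$ is the right $G$-action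 on $K^*$ where $\rho^*_g$ is the unique continuous map with $\pi_h\circ\rho^*_g=\pi_{gh}$ for all $h\in G$. Topological entropy (for $M=S$ or $M=G$ acting on the right on a compact space $L$ via $\sigma$): for an open cover $\mathcal U$ of $L$ let $N(\mathcal U)$ be the minimal cardinality of a subcover; $\mathcal U\vee\mathcal V=\{U\cap V:U\in\mathcal U,V\in\mathcal V\}$; $\mathcal U_{\sigma,F}=\bigvee_{s\in F}\sigma_s^{-1}(\mathcal U)$ for non-empty finite $F\subseteq M$. For a right F{\o}lner net $\{F_i\}$ of $M$ put $H_{\mathrm{top}}(\sigma,\mathcal U)=\lim_i\frac{\log N(\mathcal U_{\sigma,F_i})}{|F_i|}$ (the limit exists and does not depend on the net), and $h_{\mathrm{top}}(\sigma)=\sup_{\mathcal U}H_{\mathrm{top}}(\sigma,\mathcal U)\in[0,\infty]$ over all open covers. *)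

theory Defs
  imports "HOL-Analysis.Analysis" "HOL-Algebra.Divisibility"
begin

section \<open>Amenability and groups of left fractions\<close>

text \<open>Nets of finite sets are represented by filters on the powerset: a net \<open>(F\<^sub>i)\<close> over a directed
  set corresponds to the image of the tail filter of the index set under \<open>i \<mapsto> F\<^sub>i\<close>, the filter being
  proper because the index set is nonempty and directed. Conversely, every proper filter is the image
  of the tail filter of a net, and limits along the net are limits along the filter. This avoids
  quantifying over the type of indices.\<close>

definition right_folner :: "('m, 'b) monoid_scheme \<Rightarrow> 'm set filter \<Rightarrow> bool" where
  "right_folner M \<Phi> \<longleftrightarrow>
     \<Phi> \<noteq> bot \<and>
     (\<forall>\<^sub>F F in \<Phi>. finite F \<and> F \<noteq> {} \<and> F \<subseteq> carrier M) \<and>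
     (\<forall>s \<in> carrier M.
        ((\<lambda>F. real (card ((F #>\<^bsub>M\<^esub> s) - F)) / real (card F)) \<longlongrightarrow> 0) \<Phi>)"

definition right_amenable :: "('m, 'b) monoid_scheme \<Rightarrow> bool" where
  "right_amenable M \<longleftrightarrow> (\<exists>\<Phi>. right_folner M \<Phi>)"

text \<open>The group of left fractions \<open>S\<^sup>-\<^sup>1S\<close> is specified up to isomorphism, together with its canonical
  embedding \<open>\<iota>\<close>.\<close>

definition group_of_left_fractions ::
    "('s, 'b) monoid_scheme \<Rightarrow> ('g, 'c) monoid_scheme \<Rightarrow> ('s \<Rightarrow> 'g) \<Rightarrow> bool" where
  "group_of_left_fractions S G \<iota> \<longleftrightarrow>
     group G \<and> \<iota> \<in> hom S G \<and> inj_on \<iota> (carrier S) \<and>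
     carrier G = {inv\<^bsub>G\<^esub> (\<iota> s) \<otimes>\<^bsub>G\<^esub> \<iota> t | s t. s \<in> carrier S \<and> t \<in> carrier S}"


section \<open>Right actions and the Ore colocalization\<close>

definition right_action ::
    "('m, 'b) monoid_scheme \<Rightarrow> 'k topology \<Rightarrow> ('m \<Rightarrow> 'k \<Rightarrow> 'k) \<Rightarrow> bool" where
  "right_action M X \<sigma> \<longleftrightarrow>
     (\<forall>s \<in> carrier M. continuous_map X X (\<sigma> s)) \<and>
     (\<forall>x \<in> topspace X. \<sigma> \<one>\<^bsub>M\<^esub> x = x) \<and>
     (\<forall>s \<in> carrier M. \<forall>t \<in> carrier M. \<forall>x \<in> topspace X. \<sigma> (s \<otimes>\<^bsub>M\<^esub> t) x = \<sigma> t (\<sigma> s x))"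

definition surjective_core ::
    "('s, 'b) monoid_scheme \<Rightarrow> 'k topology \<Rightarrow> ('s \<Rightarrow> 'k \<Rightarrow> 'k) \<Rightarrow> 'k set" where
  "surjective_core S X \<rho> = (\<Inter>t \<in> carrier S. \<rho> t ` topspace X)"

text \<open>The inverse limit over \<open>(G, \<le>\<^sub>S)\<close> of the constant family with value the surjective core. The
  comparable pairs of indices are exactly the pairs \<open>g s \<le>\<^sub>S g\<close> with \<open>g \<in> G\<close> and \<open>s \<in> S\<close>, with transition
  map \<open>\<rho>\<^sub>s\<close> from the copy at \<open>g\<close> to the copy at \<open>g s\<close>. Its points are functions on the carrier of \<open>G\<close>
  (extensional outside it), and the canonical map \<open>\<pi>\<^sub>g\<close> is evaluation at \<open>g\<close>.\<close>

definition ore_coloc_space ::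
    "('s, 'b) monoid_scheme \<Rightarrow> ('g, 'c) monoid_scheme \<Rightarrow> ('s \<Rightarrow> 'g) \<Rightarrow>
      'k topology \<Rightarrow> ('s \<Rightarrow> 'k \<Rightarrow> 'k) \<Rightarrow> ('g \<Rightarrow> 'k) topology" where
  "ore_coloc_space S G \<iota> X \<rho> =
     subtopology
       (product_topology (\<lambda>_. subtopology X (surjective_core S X \<rho>)) (carrier G))
       {x. \<forall>g \<in> carrier G. \<forall>s \<in> carrier S. x (g \<otimes>\<^bsub>G\<^esub> \<iota> s) = \<rho> s (x g)}"

text \<open>The defining identity \<open>\<pi>\<^sub>h \<circ> \<rho>\<^sup>*\<^sub>g = \<pi>\<^sub>g\<^sub>h\<close>, for all \<open>h \<in> G\<close>, determines \<open>\<rho>\<^sup>*\<^sub>g x\<close> coordinatewise.\<close>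

definition ore_coloc_action ::
    "('g, 'c) monoid_scheme \<Rightarrow> 'g \<Rightarrow> ('g \<Rightarrow> 'k) \<Rightarrow> ('g \<Rightarrow> 'k)" where
  "ore_coloc_action G g x = (\<lambda>h \<in> carrier G. x (g \<otimes>\<^bsub>G\<^esub> h))"


section \<open>Topological entropy\<close>

definition open_cover :: "'k topology \<Rightarrow> 'k set set \<Rightarrow> bool" where
  "open_cover X \<U> \<longleftrightarrow> (\<forall>U \<in> \<U>. openin X U) \<and> \<Union>\<U> = topspace X"

definition cover_number :: "'k topology \<Rightarrow> 'k set set \<Rightarrow> nat" where
  "cover_number X \<U> = (LEAST n. \<exists>\<V> \<subseteq> \<U>. finite \<V> \<and> card \<V> = n \<and> \<Union>\<V> = topspace X)"

definition preimage_cover :: "'k topology \<Rightarrow> ('k \<Rightarrow> 'k) \<Rightarrow> 'k set set \<Rightarrow> 'k set set" where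
  "preimage_cover X f \<U> = (\<lambda>U. {x \<in> topspace X. f x \<in> U}) ` \<U>"

text \<open>The join of \<open>\<sigma>\<^sub>s\<^sup>-\<^sup>1(\<U>)\<close> over \<open>s \<in> F\<close>, only meaningful for nonempty finite \<open>F\<close>.\<close>

definition joined_cover ::
    "'k topology \<Rightarrow> ('m \<Rightarrow> 'k \<Rightarrow> 'k) \<Rightarrow> 'k set set \<Rightarrow> 'm set \<Rightarrow> 'k set set" where
  "joined_cover X \<sigma> \<U> F =
     {(\<Inter>s \<in> F. W s) | W. \<forall>s \<in> F. W s \<in> preimage_cover X (\<sigma> s) \<U>}"

text \<open>The common limit along all right Foelner nets, which exists when \<open>M\<close> is cancellative and right
  amenable and \<open>X\<close> is compact. On the empty space the convention \<open>ln 0 = 0\<close> gives entropy zero.\<close>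

definition cover_entropy ::
    "('m, 'b) monoid_scheme \<Rightarrow> 'k topology \<Rightarrow> ('m \<Rightarrow> 'k \<Rightarrow> 'k) \<Rightarrow> 'k set set \<Rightarrow> real" where
  "cover_entropy M X \<sigma> \<U> =
     (THE h. \<forall>\<Phi>. right_folner M \<Phi> \<longrightarrow>
        ((\<lambda>F. ln (real (cover_number X (joined_cover X \<sigma> \<U> F))) / real (card F)) \<longlongrightarrow> h) \<Phi>)"

definition top_entropy ::
    "('m, 'b) monoid_scheme \<Rightarrow> 'k topology \<Rightarrow> ('m \<Rightarrow> 'k \<Rightarrow> 'k) \<Rightarrow> ereal" where
  "top_entropy M X \<sigma> = (SUP \<U> \<in> {\<U>. open_cover X \<U>}. ereal (cover_entropy M X \<sigma> \<U>))"

end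

theory Submission
  imports Defs
begin

text \<open>The limits defining entropy exist by the Ornstein--Weiss lemma, which holds in every cancellative
  right amenable monoid for subadditive functions on finite sets that do not increase under left
  translation. The limit does not change when each Foelner set \<open>F\<close> is replaced by a left translate
  \<open>c F\<close>, with \<open>c\<close> depending on \<open>F\<close>.

  Let \<open>\<U>\<close> be an open cover of \<open>K\<close> and \<open>\<U>\<^sup>*\<close> its pullback along the projection \<open>\<pi>\<^sub>1\<close>, whose image is the
  surjective core. For finite \<open>F \<subseteq> S\<close>, the pullback of a subcover over \<open>F\<close> is a subcover upstairs;
  conversely a subcover upstairs yields open sets covering the core, hence by compactness covering
  \<open>\<rho>\<^sub>c(K)\<close> for some \<open>c \<in> S\<close>, which is a subcover over \<open>c F\<close>. Foelner nets of \<open>S\<close> being Foelner nets of \<open>G\<close>,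
  the entropies of \<open>\<U>\<close> and \<open>\<U>\<^sup>*\<close> agree. Finally every open cover of the inverse limit is refined by the
  pullback of some \<open>\<U>\<close> along a single \<open>\<pi>\<^sub>g\<close>; since this amounts to replacing \<open>F\<close> by \<open>F g\<close>, the covers
  \<open>\<U>\<^sup>*\<close> already compute the entropy of the colocalization.\<close>

section \<open>The Ornstein--Weiss lemma\<close>

lemma r_coset_image: "A #>\<^bsub>M\<^esub> s = (\<lambda>h. h \<otimes>\<^bsub>M\<^esub> s) ` A"
  by (auto simp: r_coset_def)

text \<open>Invariance for a fixed pair \<open>K\<close>, \<open>\<delta>\<close> lets single sets
  be estimated without mentioning nets; every Foelner net eventually satisfies it when
  \<open>K\<close> is finite and \<open>\<delta>\<close> positive.\<close>

definition folner_invariant :: "('m, 'b) monoid_scheme \<Rightarrow> 'm set \<Rightarrow> real \<Rightarrow> 'm set \<Rightarrow> bool" where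
  "folner_invariant M K \<delta> F \<longleftrightarrow> finite F \<and> F \<noteq> {} \<and> F \<subseteq> carrier M \<and>
     (\<forall>s\<in>K. real (card ((F #>\<^bsub>M\<^esub> s) - F)) \<le> \<delta> * real (card F))"

lemma right_folner_eventually_invariant:
  assumes "right_folner M \<Phi>" "finite K" "K \<subseteq> carrier M" "\<delta> > 0"
  shows "\<forall>\<^sub>F F in \<Phi>. folner_invariant M K \<delta> F"
proof -
  have "\<forall>\<^sub>F F in \<Phi>. finite F \<and> F \<noteq> {} \<and> F \<subseteq> carrier M"
    using assms(1) by (simp add: right_folner_def)
  moreover have "\<forall>\<^sub>F F in \<Phi>. \<forall>s\<in>K. real (card ((F #>\<^bsub>M\<^esub> s) - F)) / real (card F) < \<delta>"
    using assms by (intro eventually_ball_finite) (auto simp: right_folner_def intro: order_tendstoD(2))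
  ultimately show ?thesis
  proof eventually_elim
    case (elim F)
    then have "real (card F) > 0"
      by (simp add: card_gt_0_iff)
    with elim show ?case
      by (auto simp: folner_invariant_def field_simps intro: less_imp_le)
  qed
qed

section \<open>Quasi-tilings and boundaries in cancellative monoids\<close>

context monoid_cancel
begin

lemma inj_on_r_mult: "s \<in> carrier G \<Longrightarrow> A \<subseteq> carrier G \<Longrightarrow> inj_on (\<lambda>h. h \<otimes> s) A"
  by (meson inj_onI r_cancel subsetD)

lemma inj_on_l_mult: "s \<in> carrier G \<Longrightarrow> A \<subseteq> carrier G \<Longrightarrow> inj_on (\<lambda>h. s \<otimes> h) A"
  by (meson inj_onI l_cancel subsetD)

lemma card_r_coset: "s \<in> carrier G \<Longrightarrow> A \<subseteq> carrier G \<Longrightarrow> card (A #> s) = card A"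
  by (simp add: r_coset_image card_image inj_on_r_mult)

lemma card_l_mult_image: "s \<in> carrier G \<Longrightarrow> A \<subseteq> carrier G \<Longrightarrow> card ((\<otimes>) s ` A) = card A"
  by (simp add: card_image inj_on_l_mult)

text \<open>Greedy choice: \<open>C\<close> is a largest set of centres of translates of
  \<open>E\<close> inside \<open>F\<close> whose overlaps lose at most the proportion \<eta>.
  Maximality makes every translate inside \<open>F\<close> meet the union in at least
  \<open>\<eta> * card E\<close> points, and double counting then bounds the union from
  below.\<close>

lemma quasi_tiling:
  assumes E: "finite E" "E \<noteq> {}" "E \<subseteq> carrier G" and F: "finite F" "F \<subseteq> carrier G"
    and \<eta>: "0 < \<eta>" "\<eta> < 1"
  obtains C where "C \<subseteq> F" "(\<Union>c\<in>C. (\<otimes>) c ` E) \<subseteq> F"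
    "(1 - \<eta>) * (real (card C) * real (card E)) \<le> real (card (\<Union>c\<in>C. (\<otimes>) c ` E))"
    "\<eta> * (real (card F) - (\<Sum>e\<in>E. real (card ((F #> e) - F)))) \<le> real (card (\<Union>c\<in>C. (\<otimes>) c ` E))"
proof -
  define A where "A = {c\<in>F. (\<otimes>) c ` E \<subseteq> F}"
  define U where "U = (\<lambda>C. \<Union>c\<in>C. (\<otimes>) c ` E)"
  define P where "P = (\<lambda>C. C \<subseteq> A \<and> (1 - \<eta>) * (real (card C) * real (card E)) \<le> real (card (U C)))"
  have finA: "finite A" and AF: "A \<subseteq> F"
    using F by (auto simp: A_def)
  have finU: "finite (U C)" if "C \<subseteq> A" for C
    using that finA E by (auto simp: U_def intro: finite_subset)
  have "P {}"
    by (auto simp: P_def)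
  moreover have "\<forall>C. P C \<longrightarrow> card C < card A + 1"
    using finA by (auto simp: P_def less_Suc_eq_le intro: card_mono)
  ultimately have "\<exists>C. P C \<and> (\<forall>D. P D \<longrightarrow> card D \<le> card C)"
    by (rule ex_has_greatest_nat)
  then obtain C where C: "P C" and max: "\<And>D. P D \<Longrightarrow> card D \<le> card C"
    by metis
  then have CA: "C \<subseteq> A"
    by (simp add: P_def)
  \<comment> \<open>With a smaller overlap the translate would add more than
    \<open>(1 - \<eta>) * card E\<close> new points, so \<open>insert c C\<close> would still
    satisfy \<open>P\<close>.\<close>
  have overlap: "\<eta> * real (card E) \<le> real (card {e\<in>E. c \<otimes> e \<in> U C})" if c: "c \<in> A" for c
  proof (cases "c \<in> C")
    case True
    then have "{e\<in>E. c \<otimes> e \<in> U C} = E"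
      by (auto simp: U_def)
    then show ?thesis
      using \<eta> by (simp add: mult_left_le_one_le)
  next
    case False
    have cG: "c \<in> carrier G"
      using c AF F by blast
    let ?N = "{e\<in>E. c \<otimes> e \<notin> U C}"
    have "U (insert c C) = U C \<union> (\<lambda>e. c \<otimes> e) ` ?N"
      by (auto simp: U_def)
    moreover have "card ((\<lambda>e. c \<otimes> e) ` ?N) = card ?N"
      using inj_on_l_mult[OF cG, of ?N] E by (intro card_image) auto
    ultimately have "card (U (insert c C)) = card (U C) + card ?N"
      using finU[OF CA] E(1) card_Un_disjoint[of "U C" "(\<lambda>e. c \<otimes> e) ` ?N"] by fastforce
    moreover have "card (insert c C) = card C + 1"
      using False finite_subset[OF CA finA] by simp
    moreover have "\<not> P (insert c C)"
      using max[of "insert c C"] calculation(2) by auto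
    ultimately have "real (card (U C)) + real (card ?N) < (1 - \<eta>) * (real (card C + 1) * real (card E))"
      using c CA by (auto simp: P_def)
    moreover have "(1 - \<eta>) * (real (card C) * real (card E)) \<le> real (card (U C))"
      using C by (simp add: P_def)
    ultimately have "real (card ?N) < (1 - \<eta>) * real (card E)"
      by (simp add: algebra_simps)
    moreover have "card E = card {e\<in>E. c \<otimes> e \<in> U C} + card ?N"
    proof -
      have "E = {e\<in>E. c \<otimes> e \<in> U C} \<union> ?N"
        by blast
      moreover have "card ({e\<in>E. c \<otimes> e \<in> U C} \<union> ?N) = card {e\<in>E. c \<otimes> e \<in> U C} + card ?N"
        using E(1) by (intro card_Un_disjoint) auto
      ultimately show ?thesis
        by argo
    qed
    ultimately show ?thesis
      by (simp add: algebra_simps)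
  qed
  have column: "card {c\<in>A. c \<otimes> e \<in> U C} \<le> card (U C)" if "e \<in> E" for e
  proof (rule card_inj_on_le[of "\<lambda>c. c \<otimes> e"])
    show "inj_on (\<lambda>c. c \<otimes> e) {c\<in>A. c \<otimes> e \<in> U C}"
      using that E AF F by (intro inj_on_r_mult) auto
  qed (use finU[OF CA] in auto)
  \<comment> \<open>The pairs of \<open>c\<close> and \<open>e\<close> with
    \<open>c \<otimes> e\<close> in the union are counted in two ways: for fixed \<open>c\<close>
    there are many by \<open>overlap\<close>, for fixed \<open>e\<close> few by right
    cancellation.\<close>
  have "\<eta> * real (card A) * real (card E) = (\<Sum>c\<in>A. \<eta> * real (card E))"
    by simp
  also have "\<dots> \<le> (\<Sum>c\<in>A. real (card {e\<in>E. c \<otimes> e \<in> U C}))"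
    by (intro sum_mono overlap)
  also have "\<dots> = (\<Sum>e\<in>E. real (card {c\<in>A. c \<otimes> e \<in> U C}))"
    using sum_multicount_gen[OF finA E(1), of "\<lambda>c e. c \<otimes> e \<in> U C" "\<lambda>e. card {c\<in>A. c \<otimes> e \<in> U C}"]
    by (simp flip: of_nat_sum)
  also have "\<dots> \<le> (\<Sum>e\<in>E. real (card (U C)))"
    by (intro sum_mono) (simp add: column)
  also have "\<dots> = real (card (U C)) * real (card E)"
    by simp
  finally have main: "\<eta> * real (card A) \<le> real (card (U C))"
    using E by (simp add: card_gt_0_iff)
  \<comment> \<open>A point of \<open>F\<close> outside \<open>A\<close> is carried out of
    \<open>F\<close> by some \<open>e\<close> in \<open>E\<close>; right cancellation embeds these
    points into the boundary of \<open>F\<close> under \<open>e\<close>.\<close>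
  have "card F \<le> card A + (\<Sum>e\<in>E. card ((F #> e) - F))"
  proof -
    have "F - A \<subseteq> (\<Union>e\<in>E. {c\<in>F. c \<otimes> e \<notin> F})"
      by (auto simp: A_def)
    then have "card (F - A) \<le> card (\<Union>e\<in>E. {c\<in>F. c \<otimes> e \<notin> F})"
      using E F by (intro card_mono) auto
    also have "\<dots> \<le> (\<Sum>e\<in>E. card {c\<in>F. c \<otimes> e \<notin> F})"
      by (rule card_UN_le) (rule E)
    also have "\<dots> \<le> (\<Sum>e\<in>E. card ((F #> e) - F))"
    proof (rule sum_mono)
      fix e assume "e \<in> E"
      then show "card {c\<in>F. c \<otimes> e \<notin> F} \<le> card ((F #> e) - F)"
        using E F inj_on_r_mult[of e "{c\<in>F. c \<otimes> e \<notin> F}"]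
        by (intro card_inj_on_le[of "\<lambda>c. c \<otimes> e"]) (auto simp: r_coset_image)
    qed
    finally show ?thesis
      using card_Diff_subset[of A F] card_mono[OF F(1) AF] finA AF by simp
  qed
  then have cardA: "real (card F) - (\<Sum>e\<in>E. real (card ((F #> e) - F))) \<le> real (card A)"
    by (simp flip: of_nat_sum)
  show ?thesis
  proof (rule that[of C])
    show "\<eta> * (real (card F) - (\<Sum>e\<in>E. real (card ((F #> e) - F)))) \<le> real (card (\<Union>c\<in>C. (\<otimes>) c ` E))"
      using order_trans[OF mult_left_mono[OF cardA, of \<eta>] main] \<eta> by (simp add: U_def)
  qed (use C AF in \<open>auto simp: P_def A_def U_def\<close>)
qed

text \<open>By right cancellation \<open>E\<close> and \<open>E #> s\<close> have equal cardinality,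
  so removing their common part leaves equally many points on both sides.\<close>

lemma card_diff_r_coset:
  assumes E: "finite E" "E \<subseteq> carrier G" and s: "s \<in> carrier G"
  shows "card (E - (E #> s)) = card ((E #> s) - E)"
proof -
  have fin: "finite (E #> s)"
    using E by (simp add: r_coset_image)
  have "card (E - (E #> s)) + card (E \<inter> (E #> s)) = card E"
    using card_Int_Diff[OF E(1), of "E #> s"] by simp
  moreover have "card ((E #> s) - E) + card (E \<inter> (E #> s)) = card (E #> s)"
    using card_Int_Diff[OF fin, of E] by (simp add: Int_commute)
  ultimately show ?thesis
    using card_r_coset[OF s E(2)] by simp
qed

text \<open>A point \<open>x\<close> of \<open>F - U\<close> that leaves this set under
  \<open>s\<close> either leaves \<open>F\<close> or lands on some \<open>c \<otimes> e\<close> in a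
  tile. In the second case \<open>e\<close> is not in \<open>E #> s\<close>, since cancelling
  \<open>s\<close> would put \<open>x\<close> into the tile.\<close>

lemma card_diff_coset_step:
  assumes F: "finite F" "F \<subseteq> carrier G" and C: "C \<subseteq> F" and E: "finite E" "E \<subseteq> carrier G"
    and s: "s \<in> carrier G" and U: "U = (\<Union>c\<in>C. (\<otimes>) c ` E)"
  shows "card (((F - U) #> s) - (F - U)) \<le> card ((F #> s) - F) + card C * card ((E #> s) - E)"
proof -
  have finC: "finite C"
    using F C finite_subset by blast
  have CG: "c \<in> carrier G" if "c \<in> C" for c
    using that C F by blast
  have "((F - U) #> s) - (F - U) \<subseteq> ((F #> s) - F) \<union> (\<Union>c\<in>C. (\<otimes>) c ` (E - (E #> s)))"
  proof
    fix y assume "y \<in> ((F - U) #> s) - (F - U)"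
    then obtain x where x: "x \<in> F" "x \<notin> U" "y = x \<otimes> s" "y \<notin> F \<or> y \<in> U"
      by (auto simp: r_coset_image)
    show "y \<in> ((F #> s) - F) \<union> (\<Union>c\<in>C. (\<otimes>) c ` (E - (E #> s)))"
    proof (cases "y \<in> F")
      case False
      then show ?thesis
        using x by (auto simp: r_coset_image)
    next
      case True
      then obtain c e where ce: "c \<in> C" "e \<in> E" "y = c \<otimes> e"
        using x U by auto
      have "e \<notin> E #> s"
      proof
        assume "e \<in> E #> s"
        then obtain e' where e': "e' \<in> E" "e = e' \<otimes> s"
          by (auto simp: r_coset_image)
        then have "x \<otimes> s = (c \<otimes> e') \<otimes> s"
          using x ce CG s E by (metis m_assoc subsetD)
        moreover have "x \<in> carrier G" "c \<otimes> e' \<in> carrier G"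
          using x F CG[OF ce(1)] e'(1) E by auto
        ultimately have "x = c \<otimes> e'"
          using s r_cancel by blast
        then show False
          using x ce e' U by auto
      qed
      then show ?thesis
        using ce by auto
    qed
  qed
  then have "card (((F - U) #> s) - (F - U))
      \<le> card (((F #> s) - F) \<union> (\<Union>c\<in>C. (\<otimes>) c ` (E - (E #> s))))"
    using F E finC by (intro card_mono) (auto simp: r_coset_image)
  also have "\<dots> \<le> card ((F #> s) - F) + card (\<Union>c\<in>C. (\<otimes>) c ` (E - (E #> s)))"
    by (rule card_Un_le)
  also have "card (\<Union>c\<in>C. (\<otimes>) c ` (E - (E #> s))) \<le> (\<Sum>c\<in>C. card ((\<otimes>) c ` (E - (E #> s))))"
    by (rule card_UN_le) (rule finC)
  also have "\<dots> \<le> (\<Sum>c\<in>C. card (E - (E #> s)))"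
    using E by (intro sum_mono card_image_le) auto
  also have "card (E - (E #> s)) = card ((E #> s) - E)"
    by (rule card_diff_r_coset[OF E s])
  finally show ?thesis
    by simp
qed

end

section \<open>Subadditive functions along Foelner nets\<close>

text \<open>Left translation is only required not to increase \<open>f\<close>: cover numbers can
  drop when the acting map is not onto.\<close>

locale subadditive_invariant = monoid_cancel +
  fixes f :: "'a set \<Rightarrow> real"
  assumes f_empty: "f {} = 0"
    and f_nonneg: "\<And>A. 0 \<le> f A"
    and f_subadd: "\<And>A B. finite A \<Longrightarrow> finite B \<Longrightarrow> A \<subseteq> carrier G \<Longrightarrow> B \<subseteq> carrier G \<Longrightarrow> f (A \<union> B) \<le> f A + f B"
    and f_translate: "\<And>s A. s \<in> carrier G \<Longrightarrow> finite A \<Longrightarrow> A \<subseteq> carrier G \<Longrightarrow> f ((\<otimes>) s ` A) \<le> f A"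
begin

lemma f_UN_le:
  assumes "finite C" "\<And>c. c \<in> C \<Longrightarrow> finite (A c) \<and> A c \<subseteq> carrier G"
  shows "f (\<Union>c\<in>C. A c) \<le> (\<Sum>c\<in>C. f (A c))"
  using assms
proof (induction C rule: finite_induct)
  case (insert c C)
  have "f (A c \<union> (\<Union>c\<in>C. A c)) \<le> f (A c) + f (\<Union>c\<in>C. A c)"
    using insert.prems insert.hyps by (intro f_subadd) auto
  then show ?case
    using insert by force
qed (simp add: f_empty)

lemma f_le_card:
  assumes "finite A" "A \<subseteq> carrier G"
  shows "f A \<le> f {\<one>} * real (card A)"
proof -
  have "f (\<Union>a\<in>A. {a}) \<le> (\<Sum>a\<in>A. f {a})"
    using assms by (intro f_UN_le) auto
  also have "\<dots> \<le> (\<Sum>a\<in>A. f {\<one>})"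
  proof (rule sum_mono)
    fix a assume "a \<in> A"
    then show "f {a} \<le> f {\<one>}"
      using f_translate[of a "{\<one>}"] assms by auto
  qed
  finally show ?thesis
    by (simp add: mult.commute)
qed

text \<open>The eventual upper bounds of \<open>f F / card F\<close> over sufficiently invariant
  \<open>F\<close>. Their infimum will be the limit.\<close>

definition asymptotic_bounds :: "real set" where
  "asymptotic_bounds = {b. \<exists>K \<delta>. finite K \<and> K \<subseteq> carrier G \<and> \<delta> > 0 \<and>
     (\<forall>F. folner_invariant G K \<delta> F \<longrightarrow> f F \<le> b * real (card F))}"

text \<open>A self-improvement step, which replaces the usual hierarchy of tiles by a single one: if \<open>h\<close> is
  the best asymptotic upper bound and arbitrarily invariant sets \<open>E\<close> have \<open>f E \<le> l |E|\<close> with \<open>l < h\<close>,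
  then translates of one such \<open>E\<close> fill a fixed proportion of every sufficiently invariant \<open>F\<close> at a
  cost below \<open>h\<close> per point. The rest of \<open>F\<close> is either negligible or still invariant, hence costs at
  most \<open>h + t\<close> per point, so that the bound \<open>h\<close> is not optimal.\<close>

lemma improve_asymptotic_bound:
  assumes l: "l < h" and h: "\<And>b. b > h \<Longrightarrow> b \<in> asymptotic_bounds"
    and E: "\<And>K \<delta>. finite K \<Longrightarrow> K \<subseteq> carrier G \<Longrightarrow> \<delta> > 0 \<Longrightarrow>
              \<exists>E. folner_invariant G K \<delta> E \<and> f E \<le> l * real (card E)"
  shows "\<exists>b < h. b \<in> asymptotic_bounds"
proof -
  have l0: "0 \<le> l"
  proof -
    obtain E where E: "folner_invariant G {} 1 E" "f E \<le> l * real (card E)"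
      using E[of "{}" 1] by auto
    then have "0 \<le> l * real (card E)" "real (card E) > 0"
      using f_nonneg[of E] by (auto simp: folner_invariant_def card_gt_0_iff)
    then show ?thesis
      by (simp add: zero_le_mult_iff)
  qed
  \<comment> \<open>\<open>\<mu>\<close> is a cost per point strictly between \<open>l\<close> and
    \<open>h\<close>. Below, \<open>\<eta>\<close> is small enough that tiles costing
    \<open>l\<close> per point, counted with multiplicity, cost at most \<open>\<mu>\<close> per
    point of their union.\<close>
  define \<mu> where "\<mu> = (l + h) / 2"
  have \<mu>: "l < \<mu>" "\<mu> < h" "0 < \<mu>"
    using l l0 by (auto simp: \<mu>_def)
  define \<eta> where "\<eta> = min (1/2) ((\<mu> - l) / \<mu>)"
  have \<eta>: "0 < \<eta>" "\<eta> \<le> 1/2" "l \<le> (1 - \<eta>) * \<mu>"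
  proof -
    show "0 < \<eta>" "\<eta> \<le> 1/2"
      using \<mu> unfolding \<eta>_def by (auto simp only: min_less_iff_conj min.cobounded1 intro!: divide_pos_pos)
    have "\<eta> * \<mu> \<le> \<mu> - l"
      using \<mu> by (simp add: \<eta>_def min_def field_simps)
    then show "l \<le> (1 - \<eta>) * \<mu>"
      by (simp add: algebra_simps)
  qed
  \<comment> \<open>Tiles filling the proportion \<open>\<eta> / 2\<close> of \<open>F\<close> save
    \<open>2 * t * card F\<close> against the cost \<open>h\<close>. The remainder exceeds
    \<open>h\<close> by at most \<open>t\<close> per point, which leaves a net saving of
    \<open>t * card F\<close>.\<close>
  define t where "t = (h - \<mu>) * \<eta> / 4"
  have t: "t > 0"
    using \<mu> \<eta> by (simp add: t_def)
  have "h + t \<in> asymptotic_bounds"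
    using t by (intro h) simp
  then obtain K \<delta> where K: "finite K" "K \<subseteq> carrier G" "\<delta> > 0"
    and bound: "\<And>F. folner_invariant G K \<delta> F \<Longrightarrow> f F \<le> (h + t) * real (card F)"
    by (auto simp: asymptotic_bounds_def)
  \<comment> \<open>A remainder of fewer than \<open>\<gamma> * card F\<close> points can be charged
    \<open>f {\<one>}\<close> per point and still costs at most half of
    \<open>(h - \<mu>) * card F\<close>. The summand 1 keeps the denominator positive.\<close>
  define \<gamma> where "\<gamma> = (h - \<mu>) / 2 / (f {\<one>} + 1)"
  have \<gamma>: "\<gamma> > 0" "f {\<one>} * \<gamma> \<le> (h - \<mu>) / 2"
    using \<mu> f_nonneg[of "{\<one>}"] by (auto simp: \<gamma>_def field_simps)
  \<comment> \<open>The boundary allowed to a large remainder is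
    \<open>\<delta> * \<gamma> * card F\<close>. Half of it goes to the tiles, whose total size with
    multiplicity is at most \<open>2 * card F\<close>; hence the factor 1/4.\<close>
  define \<delta>1 where "\<delta>1 = \<delta> * \<gamma> / 4"
  have "\<delta>1 > 0"
    using K \<gamma> by (simp add: \<delta>1_def)
  then obtain E where E: "folner_invariant G K \<delta>1 E" "f E \<le> l * real (card E)"
    using E[OF K(1,2)] by blast
  then have E': "finite E" "E \<noteq> {}" "E \<subseteq> carrier G"
    and Einv: "\<And>s. s \<in> K \<Longrightarrow> real (card ((E #> s) - E)) \<le> \<delta>1 * real (card E)"
    by (auto simp: folner_invariant_def)
  \<comment> \<open>The first term pays the other half of that boundary. The second keeps the
    boundaries of \<open>F\<close> under all elements of \<open>E\<close> together below half of
    \<open>F\<close>, so that the tiles fill the proportion \<open>\<eta> / 2\<close>.\<close>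
  define \<delta>' where "\<delta>' = min (\<delta> * \<gamma> / 2) (1 / (2 * real (card E)))"
  have cardE: "real (card E) > 0"
    using E' by (simp add: card_gt_0_iff)
  have \<delta>': "\<delta>' > 0" "\<delta>' \<le> \<delta> * \<gamma> / 2" "\<delta>' * real (card E) \<le> 1/2"
  proof -
    show "\<delta>' > 0" "\<delta>' \<le> \<delta> * \<gamma> / 2"
      using K \<gamma> cardE by (auto simp: \<delta>'_def)
    have "\<delta>' \<le> 1 / (2 * real (card E))"
      by (simp add: \<delta>'_def)
    then show "\<delta>' * real (card E) \<le> 1/2"
      using cardE by (simp add: field_simps)
  qed
  have "f F \<le> (h - t) * real (card F)" if F: "folner_invariant G (K \<union> E) \<delta>' F" for F
  proof -
    have F': "finite F" "F \<noteq> {}" "F \<subseteq> carrier G"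
      and Finv: "\<And>s. s \<in> K \<union> E \<Longrightarrow> real (card ((F #> s) - F)) \<le> \<delta>' * real (card F)"
      using F by (auto simp: folner_invariant_def)
    have cardF: "real (card F) > 0"
      using F' by (simp add: card_gt_0_iff)
    obtain C where C: "C \<subseteq> F" "(\<Union>c\<in>C. (\<otimes>) c ` E) \<subseteq> F"
      "(1 - \<eta>) * (real (card C) * real (card E)) \<le> real (card (\<Union>c\<in>C. (\<otimes>) c ` E))"
      "\<eta> * (real (card F) - (\<Sum>e\<in>E. real (card ((F #> e) - F)))) \<le> real (card (\<Union>c\<in>C. (\<otimes>) c ` E))"
      using quasi_tiling[OF E' F'(1,3), of \<eta>] \<eta> by auto
    define U where "U = (\<Union>c\<in>C. (\<otimes>) c ` E)"
    note C = C[folded U_def]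
    have finC: "finite C"
      using C F' finite_subset by blast
    have CG: "C \<subseteq> carrier G"
      using C F' by blast
    have "(\<Sum>e\<in>E. real (card ((F #> e) - F))) \<le> (\<Sum>e\<in>E. \<delta>' * real (card F))"
      using Finv by (intro sum_mono) auto
    also have "\<dots> = (\<delta>' * real (card E)) * real (card F)"
      by simp
    also have "\<dots> \<le> 1/2 * real (card F)"
      using \<delta>' by (intro mult_right_mono) auto
    finally have "\<eta> * (real (card F) / 2) \<le> \<eta> * (real (card F) - (\<Sum>e\<in>E. real (card ((F #> e) - F))))"
      using \<eta> by (intro mult_left_mono) auto
    then have cardU: "\<eta> / 2 * real (card F) \<le> real (card U)"
      using C(4) by simp
    have "f U \<le> (\<Sum>c\<in>C. f ((\<otimes>) c ` E))"
      unfolding U_def using finC CG E' by (intro f_UN_le) auto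
    also have "\<dots> \<le> (\<Sum>c\<in>C. f E)"
      using CG E' by (intro sum_mono f_translate) auto
    also have "\<dots> \<le> l * (real (card C) * real (card E))"
      using mult_left_mono[OF E(2), of "real (card C)"] by (simp add: algebra_simps)
    also have "\<dots> \<le> ((1 - \<eta>) * \<mu>) * (real (card C) * real (card E))"
      using \<eta> by (intro mult_right_mono) auto
    also have "\<dots> \<le> \<mu> * real (card U)"
      using mult_left_mono[OF C(3), of \<mu>] \<mu> by (simp add: algebra_simps)
    finally have fU: "f U \<le> \<mu> * real (card U)" .
    have split: "real (card F) = real (card U) + real (card (F - U))"
      using card_Int_Diff[OF F'(1), of U] C(2) by (simp add: Int_absorb1)
    have "f (U \<union> (F - U)) \<le> f U + f (F - U)"
      using C(2) F' finite_subset[OF C(2)] by (intro f_subadd) auto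
    moreover have "U \<union> (F - U) = F"
      using C(2) by blast
    ultimately have fF: "f F \<le> \<mu> * real (card U) + f (F - U)"
      using fU by simp
    have \<eta>F: "(h - \<mu>) * (\<eta> / 2 * real (card F)) = 2 * t * real (card F)"
      by (simp add: t_def)
    show ?thesis
    proof (cases "real (card (F - U)) < \<gamma> * real (card F)")
      case True
      have "f (F - U) \<le> f {\<one>} * real (card (F - U))"
        using F' by (intro f_le_card) auto
      also have "\<dots> \<le> f {\<one>} * (\<gamma> * real (card F))"
        using True f_nonneg by (intro mult_left_mono) auto
      also have "\<dots> \<le> (h - \<mu>) / 2 * real (card F)"
        using mult_right_mono[OF \<gamma>(2), of "real (card F)"] by (simp add: mult.assoc)
      finally have "f F \<le> \<mu> * real (card F) + (h - \<mu>) / 2 * real (card F)"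
        using fF mult_left_mono[of "real (card U)" "real (card F)" \<mu>] split \<mu> by linarith
      also have "\<dots> \<le> (h - t) * real (card F)"
      proof -
        have "t \<le> (h - \<mu>) * (1 / 2)"
          unfolding t_def using \<mu> \<eta> mult_left_mono[of "\<eta> / 4" "1/2" "h - \<mu>"] by simp
        then have "(\<mu> + (h - \<mu>) / 2) * real (card F) \<le> (h - t) * real (card F)"
          by (intro mult_right_mono) (simp_all add: field_simps)
        then show ?thesis
          by (simp add: algebra_simps)
      qed
      finally show ?thesis .
    next
      case False
      \<comment> \<open>Removing the tiles adds their boundaries to that of \<open>F\<close>; since
        the remainder has at least \<open>\<gamma> * card F\<close> points, the sum is at most the
        fraction \<open>\<delta>\<close> of it.\<close>
      have "folner_invariant G K \<delta> (F - U)"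
        unfolding folner_invariant_def
      proof (intro conjI ballI)
        show "finite (F - U)" "F - U \<subseteq> carrier G"
          using F' by auto
        show "F - U \<noteq> {}"
          using False mult_pos_pos[OF \<gamma>(1) cardF] by force
        fix s assume s: "s \<in> K"
        have "card (((F - U) #> s) - (F - U)) \<le> card ((F #> s) - F) + card C * card ((E #> s) - E)"
          using F' C(1) E' s K U_def by (intro card_diff_coset_step) auto
        then have "real (card (((F - U) #> s) - (F - U)))
            \<le> real (card ((F #> s) - F)) + real (card C) * real (card ((E #> s) - E))"
          by (simp flip: of_nat_mult of_nat_add)
        also have "\<dots> \<le> \<delta>' * real (card F) + real (card C) * (\<delta>1 * real (card E))"
          using s by (intro add_mono mult_left_mono Finv Einv) auto
        also have "real (card C) * (\<delta>1 * real (card E)) \<le> \<delta>1 * (2 * real (card F))"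
        proof -
          have "1/2 * (real (card C) * real (card E)) \<le> (1 - \<eta>) * (real (card C) * real (card E))"
            using \<eta> by (intro mult_right_mono) auto
          then have "real (card C) * real (card E) \<le> 2 * real (card F)"
            using C(3) split by simp
          then show ?thesis
            using mult_left_mono[of _ _ \<delta>1] \<open>\<delta>1 > 0\<close> by (simp add: algebra_simps)
        qed
        also have "\<delta>' * real (card F) \<le> \<delta> * \<gamma> / 2 * real (card F)"
          using \<delta>' by (intro mult_right_mono) auto
        also have "\<delta> * \<gamma> / 2 * real (card F) + \<delta>1 * (2 * real (card F)) = \<delta> * (\<gamma> * real (card F))"
          by (simp add: \<delta>1_def)
        also have "\<dots> \<le> \<delta> * real (card (F - U))"
          using False K by (intro mult_left_mono) auto
        finally show "real (card (((F - U) #> s) - (F - U))) \<le> \<delta> * real (card (F - U))"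
          by simp
      qed
      then have "f (F - U) \<le> (h + t) * real (card (F - U))"
        by (rule bound)
      with fF have "f F \<le> h * real (card F) + t * real (card (F - U)) - (h - \<mu>) * real (card U)"
        using split by (simp add: algebra_simps)
      moreover have "2 * t * real (card F) \<le> (h - \<mu>) * real (card U)"
        using mult_left_mono[OF cardU, of "h - \<mu>"] \<mu> unfolding \<eta>F by simp
      moreover have "t * real (card (F - U)) \<le> t * real (card F)"
        using t split by (intro mult_left_mono) auto
      ultimately show ?thesis
        by (simp add: algebra_simps)
    qed
  qed
  then have "h - t \<in> asymptotic_bounds"
    using K E' \<delta>' unfolding asymptotic_bounds_def
    by (intro CollectI exI[of _ "K \<union> E"] exI[of _ \<delta>']) auto
  then show ?thesis
    using t by (intro exI[of _ "h - t"]) auto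
qed

text \<open>The limit is the infimum \<open>h\<close> of \<open>asymptotic_bounds\<close>, and
  bounds just above \<open>h\<close> control the ratio from above along every net. For
  \<open>a < h\<close>, sets of ratio at most \<open>a\<close> cannot be arbitrarily invariant,
  because \<open>improve_asymptotic_bound\<close> would yield a bound below \<open>h\<close>.
  Without Foelner nets the claim is vacuous.\<close>

theorem ornstein_weiss:
  "\<exists>h. \<forall>\<Phi>. right_folner G \<Phi> \<longrightarrow> ((\<lambda>F. f F / real (card F)) \<longlongrightarrow> h) \<Phi>"
proof (cases "\<exists>\<Phi>. right_folner G \<Phi>")
  case True
  then obtain \<Psi> where \<Psi>: "right_folner G \<Psi>"
    by blast
  have ex: "\<exists>F. folner_invariant G K \<delta> F" if "finite K" "K \<subseteq> carrier G" "\<delta> > 0" for K \<delta>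
    using eventually_happens'[OF _ right_folner_eventually_invariant[OF \<Psi> that]] \<Psi>
    by (auto simp: right_folner_def)
  have nonneg: "0 \<le> b" if b: "b \<in> asymptotic_bounds" for b
  proof -
    obtain K \<delta> where K: "finite K" "K \<subseteq> carrier G" "\<delta> > 0"
      and bound: "\<And>F. folner_invariant G K \<delta> F \<Longrightarrow> f F \<le> b * real (card F)"
      using b by (auto simp: asymptotic_bounds_def)
    obtain F where "folner_invariant G K \<delta> F"
      using ex[OF K] by blast
    then have "finite F" "F \<noteq> {}" "f F \<le> b * real (card F)"
      using bound by (auto simp: folner_invariant_def)
    then have "0 \<le> b * real (card F)" "real (card F) > 0"
      using f_nonneg[of F] by (auto simp: card_gt_0_iff)
    then show ?thesis
      by (simp add: zero_le_mult_iff)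
  qed
  have "f {\<one>} \<in> asymptotic_bounds"
    unfolding asymptotic_bounds_def
    by (intro CollectI exI[of _ "{}"] exI[of _ 1]) (auto simp: folner_invariant_def f_le_card)
  then have nonempty: "asymptotic_bounds \<noteq> {}"
    by blast
  have bdd: "bdd_below asymptotic_bounds"
    using nonneg by (rule bdd_belowI)
  define h where "h = Inf asymptotic_bounds"
  have lower: "h \<le> b" if "b \<in> asymptotic_bounds" for b
    unfolding h_def by (rule cInf_lower[OF that bdd])
  have upper: "b \<in> asymptotic_bounds" if b: "h < b" for b
  proof -
    obtain a where "a \<in> asymptotic_bounds" "a < b"
      using b cInf_lessD[OF nonempty] by (auto simp: h_def)
    then show ?thesis
      unfolding asymptotic_bounds_def
      by (smt (verit) mem_Collect_eq mult_right_mono of_nat_0_le_iff)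
  qed
  have "((\<lambda>F. f F / real (card F)) \<longlongrightarrow> h) \<Phi>" if \<Phi>: "right_folner G \<Phi>" for \<Phi>
  proof (rule order_tendstoI)
    fix a assume "a < h"
    have "\<not> (\<forall>K \<delta>. finite K \<longrightarrow> K \<subseteq> carrier G \<longrightarrow> \<delta> > 0 \<longrightarrow>
        (\<exists>E. folner_invariant G K \<delta> E \<and> f E \<le> a * real (card E)))" (is "\<not> ?R")
    proof
      assume ?R
      then have "\<exists>b<h. b \<in> asymptotic_bounds"
        using \<open>a < h\<close> upper by (intro improve_asymptotic_bound[of a]) auto
      then show False
        using lower by fastforce
    qed
    then obtain K \<delta> where K: "finite K" "K \<subseteq> carrier G" "\<delta> > 0"
      and big: "\<forall>E. \<not> (folner_invariant G K \<delta> E \<and> f E \<le> a * real (card E))"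
      by blast
    from right_folner_eventually_invariant[OF \<Phi> K]
    show "\<forall>\<^sub>F F in \<Phi>. a < f F / real (card F)"
    proof eventually_elim
      case (elim F)
      then show ?case
        using big[rule_format, of F] by (auto simp: folner_invariant_def card_gt_0_iff field_simps)
    qed
  next
    fix a assume "h < a"
    then obtain b where b: "h < b" "b < a"
      using dense by blast
    then obtain K \<delta> where K: "finite K" "K \<subseteq> carrier G" "\<delta> > 0"
      and small: "\<And>F. folner_invariant G K \<delta> F \<Longrightarrow> f F \<le> b * real (card F)"
      using upper[OF b(1)] by (auto simp: asymptotic_bounds_def)
    from right_folner_eventually_invariant[OF \<Phi> K]
    show "\<forall>\<^sub>F F in \<Phi>. f F / real (card F) < a"
    proof eventually_elim
      case (elim F)
      then have "real (card F) > 0"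
        by (auto simp: folner_invariant_def card_gt_0_iff)
      moreover have "f F < a * real (card F)"
        using small[OF elim] mult_strict_right_mono[OF b(2) calculation] by linarith
      ultimately show ?case
        by (simp add: field_simps)
    qed
  qed
  then show ?thesis
    by blast
qed auto

end

section \<open>Entropy of open covers\<close>

definition cylinder :: "'k topology \<Rightarrow> ('m \<Rightarrow> 'k \<Rightarrow> 'k) \<Rightarrow> 'm set \<Rightarrow> ('m \<Rightarrow> 'k set) \<Rightarrow> 'k set" where
  "cylinder X \<sigma> F u = {x \<in> topspace X. \<forall>s\<in>F. \<sigma> s x \<in> u s}"

text \<open>For empty \<open>F\<close> the intersection is the whole type while the cylinder is the
  space, hence the hypothesis.\<close>

lemma joined_cover_eq_cylinders:
  assumes "F \<noteq> {}"
  shows "joined_cover X \<sigma> \<U> F = cylinder X \<sigma> F ` (F \<rightarrow> \<U>)"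
proof (intro equalityI subsetI)
  fix J assume "J \<in> joined_cover X \<sigma> \<U> F"
  then obtain W where J: "J = (\<Inter>s\<in>F. W s)"
    and "\<forall>s\<in>F. \<exists>U. U \<in> \<U> \<and> W s = {x \<in> topspace X. \<sigma> s x \<in> U}"
    by (auto simp: joined_cover_def preimage_cover_def image_iff Bex_def)
  then obtain u where u: "\<forall>s\<in>F. u s \<in> \<U> \<and> W s = {x \<in> topspace X. \<sigma> s x \<in> u s}"
    by metis
  have "J = cylinder X \<sigma> F u"
    using u assms by (auto simp: J cylinder_def)
  then show "J \<in> cylinder X \<sigma> F ` (F \<rightarrow> \<U>)"
    using u by blast
next
  fix J assume "J \<in> cylinder X \<sigma> F ` (F \<rightarrow> \<U>)"
  then obtain u where u: "u \<in> F \<rightarrow> \<U>" and J: "J = cylinder X \<sigma> F u"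
    by blast
  have "J = (\<Inter>s\<in>F. {x \<in> topspace X. \<sigma> s x \<in> u s})"
    using assms by (auto simp: J cylinder_def)
  moreover have "\<forall>s\<in>F. {x \<in> topspace X. \<sigma> s x \<in> u s} \<in> preimage_cover X (\<sigma> s) \<U>"
    using u by (auto simp: preimage_cover_def)
  ultimately show "J \<in> joined_cover X \<sigma> \<U> F"
    unfolding joined_cover_def by blast
qed

text \<open>A member of the joined cover is named by a word \<open>u\<close> assigning an element of the cover to each
  \<open>s \<in> F\<close>. Counting words instead of sets lets subcovers be moved between spaces and index sets even
  when different words name the same set.\<close>

definition covering_words ::
    "'k topology \<Rightarrow> ('m \<Rightarrow> 'k \<Rightarrow> 'k) \<Rightarrow> 'k set set \<Rightarrow> 'm set \<Rightarrow> ('m \<Rightarrow> 'k set) set \<Rightarrow> bool" where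
  "covering_words X \<sigma> \<U> F A \<longleftrightarrow>
     finite A \<and> A \<subseteq> (F \<rightarrow> \<U>) \<and> (\<forall>x\<in>topspace X. \<exists>u\<in>A. \<forall>s\<in>F. \<sigma> s x \<in> u s)"

lemma covering_words_subcover:
  assumes A: "covering_words X \<sigma> \<U> F A" and F: "F \<noteq> {}"
  shows "cylinder X \<sigma> F ` A \<subseteq> joined_cover X \<sigma> \<U> F" "finite (cylinder X \<sigma> F ` A)"
    "\<Union>(cylinder X \<sigma> F ` A) = topspace X"
proof -
  show "cylinder X \<sigma> F ` A \<subseteq> joined_cover X \<sigma> \<U> F" "finite (cylinder X \<sigma> F ` A)"
    using A unfolding joined_cover_eq_cylinders[OF F] covering_words_def by (blast intro: image_mono)+
  show "\<Union>(cylinder X \<sigma> F ` A) = topspace X"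
    using A by (auto simp: covering_words_def cylinder_def)
qed

lemma cover_number_joined_le:
  assumes "covering_words X \<sigma> \<U> F A" "F \<noteq> {}"
  shows "cover_number X (joined_cover X \<sigma> \<U> F) \<le> card A"
proof -
  let ?V = "cylinder X \<sigma> F ` A"
  note covering_words_subcover[OF assms]
  then have "cover_number X (joined_cover X \<sigma> \<U> F) \<le> card ?V"
    unfolding cover_number_def by (intro Least_le) blast
  also have "\<dots> \<le> card A"
    using assms by (intro card_image_le) (auto simp: covering_words_def)
  finally show ?thesis .
qed

text \<open>Choosing one word for each member of a minimal subcover makes words and sets equally
  numerous. The words \<open>B\<close> ensure that some finite subcover exists, so that the least
  number is attained.\<close>

lemma cover_number_joined_attained:
  assumes "covering_words X \<sigma> \<U> F B" "F \<noteq> {}"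
  obtains A where "covering_words X \<sigma> \<U> F A" "card A = cover_number X (joined_cover X \<sigma> \<U> F)"
proof -
  let ?P = "\<lambda>n. \<exists>\<V>\<subseteq>joined_cover X \<sigma> \<U> F. finite \<V> \<and> card \<V> = n \<and> \<Union>\<V> = topspace X"
  let ?V = "cylinder X \<sigma> F ` B"
  note covering_words_subcover[OF assms]
  then have "?P (card ?V)"
    by blast
  then have "?P (cover_number X (joined_cover X \<sigma> \<U> F))"
    unfolding cover_number_def by (rule LeastI)
  then obtain \<V> where V: "\<V> \<subseteq> cylinder X \<sigma> F ` (F \<rightarrow> \<U>)" "finite \<V>" "\<Union>\<V> = topspace X"
    "card \<V> = cover_number X (joined_cover X \<sigma> \<U> F)"
    using assms by (auto simp: joined_cover_eq_cylinders)
  obtain A where A: "A \<subseteq> (F \<rightarrow> \<U>)" "inj_on (cylinder X \<sigma> F) A" "\<V> = cylinder X \<sigma> F ` A"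
    using subset_image_inj[of \<V> "cylinder X \<sigma> F" "F \<rightarrow> \<U>"] V(1) by auto
  show ?thesis
  proof (rule that[of A])
    show "covering_words X \<sigma> \<U> F A"
      unfolding covering_words_def
    proof (intro conjI ballI)
      show "finite A"
        using A V(2) finite_imageD by blast
      fix x assume "x \<in> topspace X"
      then show "\<exists>u\<in>A. \<forall>s\<in>F. \<sigma> s x \<in> u s"
        using V(3) A(3) by (auto simp: cylinder_def)
    qed (use A in auto)
    show "card A = cover_number X (joined_cover X \<sigma> \<U> F)"
      using V(4) A by (simp add: card_image)
  qed
qed

text \<open>A transfer principle for moving covers between spaces and index sets: a map of words may
  identify words but cannot increase their number.\<close>

lemma cover_number_joined_mono:
  assumes "covering_words X \<sigma> \<U> F B" "F \<noteq> {}" "E \<noteq> {}"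
    and "\<And>A. covering_words X \<sigma> \<U> F A \<Longrightarrow> covering_words Y \<tau> \<V> E (\<psi> ` A)"
  shows "cover_number Y (joined_cover Y \<tau> \<V> E) \<le> cover_number X (joined_cover X \<sigma> \<U> F)"
proof -
  obtain A where A: "covering_words X \<sigma> \<U> F A" "card A = cover_number X (joined_cover X \<sigma> \<U> F)"
    using cover_number_joined_attained[OF assms(1,2)] .
  have "cover_number Y (joined_cover Y \<tau> \<V> E) \<le> card (\<psi> ` A)"
    using assms A by (intro cover_number_joined_le) auto
  also have "\<dots> \<le> card A"
    using A by (intro card_image_le) (auto simp: covering_words_def)
  finally show ?thesis
    using A by simp
qed

lemma (in monoid) covering_words_exist:
  assumes X: "compact_space X" and \<sigma>: "right_action G X \<sigma>" and \<U>: "open_cover X \<U>"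
    and F: "finite F" "F \<subseteq> carrier G"
  obtains A where "covering_words X \<sigma> \<U> F A"
proof -
  obtain \<V> where V: "finite \<V>" "\<V> \<subseteq> \<U>" "topspace X \<subseteq> \<Union>\<V>"
    using X \<U> unfolding compact_space_alt open_cover_def by (metis order_refl)
  have "\<exists>u\<in>PiE F (\<lambda>_. \<V>). \<forall>s\<in>F. \<sigma> s x \<in> u s" if x: "x \<in> topspace X" for x
  proof -
    have "\<exists>V\<in>\<V>. \<sigma> s x \<in> V" if "s \<in> F" for s
    proof -
      have "continuous_map X X (\<sigma> s)"
        using \<sigma> F that by (auto simp: right_action_def)
      then have "\<sigma> s x \<in> topspace X"
        using x by (auto simp: continuous_map_def)
      then show ?thesis
        using V by blast
    qed
    then obtain v where "\<forall>s\<in>F. v s \<in> \<V> \<and> \<sigma> s x \<in> v s"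
      by metis
    then show ?thesis
      by (intro bexI[of _ "restrict v F"]) auto
  qed
  then have "covering_words X \<sigma> \<U> F (PiE F (\<lambda>_. \<V>))"
    using V F by (auto simp: covering_words_def finite_PiE)
  then show ?thesis
    by (rule that)
qed

section \<open>Cover numbers of a compact action and existence of the entropy limit\<close>

locale compact_action = monoid_cancel G for G (structure) +
  fixes X :: "'k topology" and \<sigma> :: "'a \<Rightarrow> 'k \<Rightarrow> 'k"
  assumes compact: "compact_space X" and action: "right_action G X \<sigma>"
begin

lemma act_closed: "s \<in> carrier G \<Longrightarrow> x \<in> topspace X \<Longrightarrow> \<sigma> s x \<in> topspace X"
  using action by (auto simp: right_action_def continuous_map_def)

lemma act_mult:
  "s \<in> carrier G \<Longrightarrow> t \<in> carrier G \<Longrightarrow> x \<in> topspace X \<Longrightarrow> \<sigma> (s \<otimes> t) x = \<sigma> t (\<sigma> s x)"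
  using action by (auto simp: right_action_def)

lemma act_one: "x \<in> topspace X \<Longrightarrow> \<sigma> \<one> x = x"
  using action by (auto simp: right_action_def)

lemma cover_number_joined_mono_compact:
  assumes "open_cover X \<U>" "finite F" "F \<subseteq> carrier G" "F \<noteq> {}" "E \<noteq> {}"
    and "\<And>A. covering_words X \<sigma> \<U> F A \<Longrightarrow> covering_words Y \<tau> \<V> E (\<psi> ` A)"
  shows "cover_number Y (joined_cover Y \<tau> \<V> E) \<le> cover_number X (joined_cover X \<sigma> \<U> F)"
  using covering_words_exist[OF compact action assms(1,2,3)] cover_number_joined_mono assms
  by metis

text \<open>A word for \<open>F\<close> at the point \<open>\<sigma> s x\<close> serves as a word
  for the translate of \<open>F\<close> at \<open>x\<close>; left cancellation recovers the index
  \<open>t\<close> from \<open>s \<otimes> t\<close>.\<close>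

lemma cover_number_joined_translate:
  assumes U: "open_cover X \<U>" and F: "finite F" "F \<subseteq> carrier G" "F \<noteq> {}" and s: "s \<in> carrier G"
  shows "cover_number X (joined_cover X \<sigma> \<U> ((\<otimes>) s ` F)) \<le> cover_number X (joined_cover X \<sigma> \<U> F)"
proof (rule cover_number_joined_mono_compact[OF U F, where \<psi> = "\<lambda>u. u \<circ> the_inv_into F ((\<otimes>) s)"])
  fix A assume A: "covering_words X \<sigma> \<U> F A"
  have inv: "the_inv_into F ((\<otimes>) s) (s \<otimes> t) = t" if "t \<in> F" for t
    using the_inv_into_f_f[OF inj_on_l_mult[OF s F(2)] that] .
  show "covering_words X \<sigma> \<U> ((\<otimes>) s ` F) ((\<lambda>u. u \<circ> the_inv_into F ((\<otimes>) s)) ` A)"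
    unfolding covering_words_def
  proof (intro conjI ballI)
    show "finite ((\<lambda>u. u \<circ> the_inv_into F ((\<otimes>) s)) ` A)"
      using A by (simp add: covering_words_def)
    show "(\<lambda>u. u \<circ> the_inv_into F ((\<otimes>) s)) ` A \<subseteq> (\<otimes>) s ` F \<rightarrow> \<U>"
    proof clarify
      fix u t assume "u \<in> A" "t \<in> F"
      then show "(u \<circ> the_inv_into F ((\<otimes>) s)) (s \<otimes> t) \<in> \<U>"
        using A inv[of t] by (auto simp: covering_words_def)
    qed
    fix x assume x: "x \<in> topspace X"
    then obtain u where "u \<in> A" "\<forall>t\<in>F. \<sigma> t (\<sigma> s x) \<in> u t"
      using A act_closed[OF s x] by (auto simp: covering_words_def)
    then show "\<exists>v\<in>(\<lambda>u. u \<circ> the_inv_into F ((\<otimes>) s)) ` A. \<forall>t\<in>(\<otimes>) s ` F. \<sigma> t x \<in> v t"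
      using F s x by (force simp: inv act_mult subset_iff)
  qed
qed (use F in auto)

lemma cover_number_joined_Un:
  assumes U: "open_cover X \<U>" and E: "finite E" "E \<subseteq> carrier G" "E \<noteq> {}"
    and F: "finite F" "F \<subseteq> carrier G" "F \<noteq> {}"
  shows "cover_number X (joined_cover X \<sigma> \<U> (E \<union> F))
    \<le> cover_number X (joined_cover X \<sigma> \<U> E) * cover_number X (joined_cover X \<sigma> \<U> F)"
proof -
  obtain A where A: "covering_words X \<sigma> \<U> E A" "card A = cover_number X (joined_cover X \<sigma> \<U> E)"
    using covering_words_exist[OF compact action U E(1,2)] cover_number_joined_attained[OF _ E(3)]
    by metis
  obtain B where B: "covering_words X \<sigma> \<U> F B" "card B = cover_number X (joined_cover X \<sigma> \<U> F)"
    using covering_words_exist[OF compact action U F(1,2)] cover_number_joined_attained[OF _ F(3)]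
    by metis
  let ?g = "\<lambda>(u, v) s. if s \<in> E then u s else v s"
  have "covering_words X \<sigma> \<U> (E \<union> F) (?g ` (A \<times> B))"
    unfolding covering_words_def
  proof (intro conjI ballI)
    show "finite (?g ` (A \<times> B))" "?g ` (A \<times> B) \<subseteq> E \<union> F \<rightarrow> \<U>"
      using A B by (auto simp: covering_words_def Pi_iff subset_iff)
    fix x assume x: "x \<in> topspace X"
    obtain u where u: "u \<in> A" "\<forall>s\<in>E. \<sigma> s x \<in> u s"
      using A(1) x by (auto simp: covering_words_def)
    obtain v where v: "v \<in> B" "\<forall>s\<in>F. \<sigma> s x \<in> v s"
      using B(1) x by (auto simp: covering_words_def)
    show "\<exists>w\<in>?g ` (A \<times> B). \<forall>s\<in>E \<union> F. \<sigma> s x \<in> w s"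
      using u v by (intro bexI[of _ "?g (u, v)"]) auto
  qed
  then have "cover_number X (joined_cover X \<sigma> \<U> (E \<union> F)) \<le> card (?g ` (A \<times> B))"
    using E by (intro cover_number_joined_le) auto
  also have "\<dots> \<le> card (A \<times> B)"
    using A B by (intro card_image_le) (auto simp: covering_words_def)
  finally show ?thesis
    using A B by (simp add: card_cartesian_product)
qed

text \<open>The value 0 on the empty set is the one \<open>subadditive_invariant\<close> demands;
  joined covers are meaningful only for nonempty finite index sets.\<close>

definition log_cover_number :: "'k set set \<Rightarrow> 'a set \<Rightarrow> real" where
  "log_cover_number \<U> F = (if finite F \<and> F \<noteq> {}
     then ln (real (cover_number X (joined_cover X \<sigma> \<U> F))) else 0)"

lemma ln_of_nat_nonneg: "0 \<le> ln (real n)"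
  by (cases "n = 0") auto

lemma subadditive_invariant_log_cover_number:
  assumes U: "open_cover X \<U>"
  shows "subadditive_invariant G (log_cover_number \<U>)"
proof unfold_locales
  fix A B assume AB: "finite A" "finite B" "A \<subseteq> carrier G" "B \<subseteq> carrier G"
  let ?N = "\<lambda>F. cover_number X (joined_cover X \<sigma> \<U> F)"
  show "log_cover_number \<U> (A \<union> B) \<le> log_cover_number \<U> A + log_cover_number \<U> B"
  proof (cases "A = {} \<or> B = {}")
    case False
    then have le: "?N (A \<union> B) \<le> ?N A * ?N B"
      using AB by (intro cover_number_joined_Un[OF U]) auto
    have "ln (real (?N (A \<union> B))) \<le> ln (real (?N A)) + ln (real (?N B))"
    \<comment> \<open>Logarithms are compared only for positive cover numbers; the convention
      \<open>ln 0 = 0\<close> settles the other case.\<close>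
    proof (cases "?N (A \<union> B) = 0")
      case True
      then show ?thesis
        by (simp add: ln_of_nat_nonneg)
    next
      case nonzero: False
      then have pos: "?N A > 0" "?N B > 0"
        using le by (auto intro: Nat.gr0I)
      have "ln (real (?N (A \<union> B))) \<le> ln (real (?N A * ?N B))"
        using nonzero le pos by (subst ln_le_cancel_iff) (auto simp flip: of_nat_mult)
      then show ?thesis
        using pos by (simp add: ln_mult)
    qed
    then show ?thesis
      using False AB by (simp add: log_cover_number_def)
  qed (auto simp: log_cover_number_def)
next
  fix s A assume A: "s \<in> carrier G" "finite A" "A \<subseteq> carrier G"
  let ?N = "\<lambda>F. cover_number X (joined_cover X \<sigma> \<U> F)"
  show "log_cover_number \<U> ((\<otimes>) s ` A) \<le> log_cover_number \<U> A"
  proof (cases "A = {} \<or> ?N ((\<otimes>) s ` A) = 0")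
    case True
    then show ?thesis
      by (auto simp: log_cover_number_def ln_of_nat_nonneg)
  next
    case False
    then show ?thesis
      using A cover_number_joined_translate[OF U A(2,3) _ A(1)] by (auto simp: log_cover_number_def)
  qed
qed (auto simp: log_cover_number_def ln_of_nat_nonneg)

text \<open>The definite description is justified here: the Ornstein--Weiss lemma provides one limit
  for all Foelner nets, and the net \<open>\<Phi>\<close> makes it unique.\<close>

lemma tendsto_cover_entropy:
  assumes U: "open_cover X \<U>" and \<Phi>: "right_folner G \<Phi>"
  shows "((\<lambda>F. ln (real (cover_number X (joined_cover X \<sigma> \<U> F))) / real (card F))
           \<longlongrightarrow> cover_entropy G X \<sigma> \<U>) \<Phi>"
proof -
  let ?r = "\<lambda>F. ln (real (cover_number X (joined_cover X \<sigma> \<U> F))) / real (card F)"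
  interpret subadditive_invariant G "log_cover_number \<U>"
    by (rule subadditive_invariant_log_cover_number[OF U])
  obtain h where h: "\<And>\<Psi>. right_folner G \<Psi> \<Longrightarrow> ((\<lambda>F. log_cover_number \<U> F / real (card F)) \<longlongrightarrow> h) \<Psi>"
    using ornstein_weiss by blast
  have lim: "(?r \<longlongrightarrow> h) \<Psi>" if \<Psi>: "right_folner G \<Psi>" for \<Psi>
  proof -
    have "\<forall>\<^sub>F F in \<Psi>. finite F \<and> F \<noteq> {} \<and> F \<subseteq> carrier G"
      using \<Psi> by (simp add: right_folner_def)
    then have "\<forall>\<^sub>F F in \<Psi>. log_cover_number \<U> F / real (card F) = ?r F"
      by eventually_elim (simp add: log_cover_number_def)
    then show ?thesis
      using h[OF \<Psi>] by (rule Lim_transform_eventually[rotated])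
  qed
  have "cover_entropy G X \<sigma> \<U> = h"
    unfolding cover_entropy_def
  proof (rule the_equality)
    fix h' assume "\<forall>\<Psi>. right_folner G \<Psi> \<longrightarrow> (?r \<longlongrightarrow> h') \<Psi>"
    then show "h' = h"
      using \<Phi> lim[OF \<Phi>] by (auto simp: right_folner_def intro: tendsto_unique[of \<Phi>])
  qed (use lim in blast)
  then show ?thesis
    using lim[OF \<Phi>] by simp
qed

end

section \<open>Bounds on entropy and comparison along transformed Foelner nets\<close>

lemma (in compact_action) cover_entropy_nonneg:
  assumes "open_cover X \<U>" and \<Phi>: "right_folner G \<Phi>"
  shows "0 \<le> cover_entropy G X \<sigma> \<U>"
  using \<Phi> by (intro tendsto_lowerbound[OF tendsto_cover_entropy[OF assms]])
    (auto simp: right_folner_def ln_of_nat_nonneg)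

lemma (in compact_action) cover_entropy_empty_space:
  assumes "open_cover X \<U>" and \<Phi>: "right_folner G \<Phi>" and "topspace X = {}"
  shows "cover_entropy G X \<sigma> \<U> = 0"
proof -
  have "cover_number X \<V> = 0" for \<V>
    unfolding cover_number_def using assms(3) by (intro Least_eq_0) (auto intro!: exI[of _ "{}"])
  then have "((\<lambda>F. 0) \<longlongrightarrow> cover_entropy G X \<sigma> \<U>) \<Phi>"
    using tendsto_cover_entropy[OF assms(1,2)] by simp
  then show ?thesis
    using \<Phi> by (auto simp: right_folner_def tendsto_const_iff)
qed

lemma ln_of_nat_mono: "m \<le> n \<Longrightarrow> ln (real m) \<le> ln (real n)"
  by (cases "m = 0"; cases "n = 0") auto

text \<open>Since the limits do not depend on the net, two entropies can be compared along different
  nets \<open>T F\<close> and \<open>R F\<close> with a common index; equal cardinalities reduce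
  this to cover numbers.\<close>

lemma cover_entropy_le_along:
  assumes "compact_action M X \<sigma>" "compact_action N Y \<tau>"
    and "open_cover X \<U>" "open_cover Y \<V>"
    and M: "right_folner M (filtermap T \<Phi>)" and N: "right_folner N (filtermap R \<Phi>)"
    and le: "\<forall>\<^sub>F F in \<Phi>. card (T F) = card (R F) \<and>
      cover_number X (joined_cover X \<sigma> \<U> (T F)) \<le> cover_number Y (joined_cover Y \<tau> \<V> (R F))"
  shows "cover_entropy M X \<sigma> \<U> \<le> cover_entropy N Y \<tau> \<V>"
proof (rule tendsto_le)
  show "\<Phi> \<noteq> bot"
    using M by (auto simp: right_folner_def filtermap_bot_iff)
  show "((\<lambda>F. ln (real (cover_number X (joined_cover X \<sigma> \<U> (T F)))) / real (card (T F)))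
      \<longlongrightarrow> cover_entropy M X \<sigma> \<U>) \<Phi>"
    using compact_action.tendsto_cover_entropy[OF assms(1,3) M] by (simp add: filterlim_filtermap)
  show "((\<lambda>F. ln (real (cover_number Y (joined_cover Y \<tau> \<V> (R F)))) / real (card (R F)))
      \<longlongrightarrow> cover_entropy N Y \<tau> \<V>) \<Phi>"
    using compact_action.tendsto_cover_entropy[OF assms(2,4) N] by (simp add: filterlim_filtermap)
  show "\<forall>\<^sub>F F in \<Phi>. ln (real (cover_number X (joined_cover X \<sigma> \<U> (T F)))) / real (card (T F))
      \<le> ln (real (cover_number Y (joined_cover Y \<tau> \<V> (R F)))) / real (card (R F))"
    using le
  proof eventually_elim
    case (elim F)
    then show ?case
      by (auto intro!: divide_right_mono ln_of_nat_mono)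
  qed
qed

text \<open>Two boundary terms are allowed because a fraction is controlled by its numerator and its
  denominator; for translates a single element serves as both \<open>p\<close> and
  \<open>q\<close>.\<close>

lemma right_folner_filtermap:
  assumes \<Phi>: "right_folner M \<Phi>"
    and T: "\<And>F. finite F \<Longrightarrow> F \<noteq> {} \<Longrightarrow> F \<subseteq> carrier M \<Longrightarrow>
              finite (T F) \<and> T F \<noteq> {} \<and> T F \<subseteq> carrier N \<and> card (T F) = card F"
    and inv: "\<And>s. s \<in> carrier N \<Longrightarrow> \<exists>p\<in>carrier M. \<exists>q\<in>carrier M. \<forall>F. finite F \<longrightarrow> F \<noteq> {} \<longrightarrow> F \<subseteq> carrier M \<longrightarrow>
      card ((T F #>\<^bsub>N\<^esub> s) - T F) \<le> card ((F #>\<^bsub>M\<^esub> p) - F) + card ((F #>\<^bsub>M\<^esub> q) - F)"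
  shows "right_folner N (filtermap T \<Phi>)"
  unfolding right_folner_def
proof (intro conjI ballI)
  have good: "\<forall>\<^sub>F F in \<Phi>. finite F \<and> F \<noteq> {} \<and> F \<subseteq> carrier M"
    using \<Phi> by (simp add: right_folner_def)
  show "filtermap T \<Phi> \<noteq> bot"
    using \<Phi> by (simp add: right_folner_def filtermap_bot_iff)
  show "\<forall>\<^sub>F F in filtermap T \<Phi>. finite F \<and> F \<noteq> {} \<and> F \<subseteq> carrier N"
    unfolding eventually_filtermap using good by eventually_elim (use T in blast)
  fix s assume "s \<in> carrier N"
  then obtain p q where pq: "p \<in> carrier M" "q \<in> carrier M"
    and le: "\<And>F. finite F \<Longrightarrow> F \<noteq> {} \<Longrightarrow> F \<subseteq> carrier M \<Longrightarrow>
      card ((T F #>\<^bsub>N\<^esub> s) - T F) \<le> card ((F #>\<^bsub>M\<^esub> p) - F) + card ((F #>\<^bsub>M\<^esub> q) - F)"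
    using inv by blast
  let ?b = "\<lambda>p F. real (card ((F #>\<^bsub>M\<^esub> p) - F)) / real (card F)"
  have "((\<lambda>F. ?b p F + ?b q F) \<longlongrightarrow> 0) \<Phi>"
    using tendsto_add[of "?b p" 0 \<Phi> "?b q" 0] pq \<Phi> by (auto simp: right_folner_def)
  moreover have "\<forall>\<^sub>F F in \<Phi>. norm (real (card ((T F #>\<^bsub>N\<^esub> s) - T F)) / real (card (T F))) \<le> ?b p F + ?b q F"
    using good
  proof eventually_elim
    case (elim F)
    have "real (card ((T F #>\<^bsub>N\<^esub> s) - T F)) \<le> real (card ((F #>\<^bsub>M\<^esub> p) - F)) + real (card ((F #>\<^bsub>M\<^esub> q) - F))"
      using le[of F] elim by (simp flip: of_nat_add)
    then show ?case
      using T[of F] elim by (simp add: divide_right_mono flip: add_divide_distrib)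
  qed
  ultimately show "((\<lambda>F. real (card ((F #>\<^bsub>N\<^esub> s) - F)) / real (card F)) \<longlongrightarrow> 0) (filtermap T \<Phi>)"
    unfolding filterlim_filtermap by (rule Lim_null_comparison[rotated])
qed

text \<open>Left and right multiplication commute, so the boundary of a left translate lies in the
  translate of the boundary, whichever \<open>c F\<close> is chosen.\<close>

lemma (in monoid_cancel) right_folner_left_translates:
  assumes \<Phi>: "right_folner G \<Phi>" and c: "\<And>F. c F \<in> carrier G"
  shows "right_folner G (filtermap (\<lambda>F. (\<otimes>) (c F) ` F) \<Phi>)"
proof (rule right_folner_filtermap[OF \<Phi>], goal_cases)
  case (1 F)
  then show ?case
    using c card_l_mult_image[OF c] by auto
next
  case (2 s)
  have "card (((\<otimes>) (c F) ` F #> s) - (\<otimes>) (c F) ` F) \<le> card ((F #> s) - F) + card ((F #> s) - F)"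
    if F: "finite F" "F \<subseteq> carrier G" for F
  proof -
    have "((\<otimes>) (c F) ` F #> s) - (\<otimes>) (c F) ` F \<subseteq> (\<otimes>) (c F) ` ((F #> s) - F)"
    proof
      fix y assume y: "y \<in> ((\<otimes>) (c F) ` F #> s) - (\<otimes>) (c F) ` F"
      then obtain f where f: "f \<in> F" "y = (c F \<otimes> f) \<otimes> s"
        by (auto simp: r_coset_image)
      then have "y = c F \<otimes> (f \<otimes> s)"
        using m_assoc[OF c, of f s] 2 F by auto
      moreover have "f \<otimes> s \<notin> F"
        using y calculation by auto
      ultimately show "y \<in> (\<otimes>) (c F) ` ((F #> s) - F)"
        using f by (auto simp: r_coset_image)
    qed
    then have "card (((\<otimes>) (c F) ` F #> s) - (\<otimes>) (c F) ` F) \<le> card ((\<otimes>) (c F) ` ((F #> s) - F))"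
      using F by (intro card_mono) (auto simp: r_coset_image)
    also have "\<dots> \<le> card ((F #> s) - F)"
      using F by (intro card_image_le) (auto simp: r_coset_image)
    finally show ?thesis
      by simp
  qed
  then show ?case
    using 2 by blast
qed

text \<open>The boundary of \<open>F #> g\<close> under \<open>s\<close> is the boundary of
  \<open>F\<close> under the conjugate \<open>g \<otimes> s \<otimes> inv g\<close>, shifted by
  \<open>g\<close>.\<close>

lemma (in group) right_folner_right_translate:
  assumes \<Phi>: "right_folner G \<Phi>" and g: "g \<in> carrier G"
  shows "right_folner G (filtermap (\<lambda>F. F #> g) \<Phi>)"
proof (rule right_folner_filtermap[OF \<Phi>], goal_cases)
  case (1 F)
  then show ?case
    using g card_r_coset[OF g, of F] by (auto simp: r_coset_image)
next
  case (2 s)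
  let ?p = "g \<otimes> s \<otimes> inv g"
  have "card (((F #> g) #> s) - (F #> g)) \<le> card ((F #> ?p) - F) + card ((F #> ?p) - F)"
    if F: "finite F" "F \<subseteq> carrier G" for F
  proof -
    have "((F #> g) #> s) - (F #> g) \<subseteq> (\<lambda>x. x \<otimes> g) ` ((F #> ?p) - F)"
    proof
      fix y assume y: "y \<in> ((F #> g) #> s) - (F #> g)"
      then obtain f where f: "f \<in> F" "y = f \<otimes> g \<otimes> s"
        by (auto simp: r_coset_image)
      then have "y = (f \<otimes> ?p) \<otimes> g"
        using g 2 F by (auto simp: m_assoc subset_iff)
      moreover have "f \<otimes> ?p \<notin> F"
        using y calculation by (auto simp: r_coset_image)
      ultimately show "y \<in> (\<lambda>x. x \<otimes> g) ` ((F #> ?p) - F)"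
        using f by (auto simp: r_coset_image)
    qed
    then have "card (((F #> g) #> s) - (F #> g)) \<le> card ((\<lambda>x. x \<otimes> g) ` ((F #> ?p) - F))"
      using F by (intro card_mono) (auto simp: r_coset_image)
    also have "\<dots> \<le> card ((F #> ?p) - F)"
      using F by (intro card_image_le) (auto simp: r_coset_image)
    finally show ?thesis
      by simp
  qed
  moreover have "?p \<in> carrier G"
    using g 2 by simp
  ultimately show ?case
    by blast
qed

section \<open>Groups of left fractions\<close>

locale left_fractions = S: monoid_cancel S + G: group G
  for S :: "('s, 'b) monoid_scheme" and G :: "('g, 'c) monoid_scheme" +
  fixes \<iota> :: "'s \<Rightarrow> 'g"
  assumes fractions: "group_of_left_fractions S G \<iota>"
begin

lemma \<iota>_closed [simp]: "s \<in> carrier S \<Longrightarrow> \<iota> s \<in> carrier G"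
  using fractions by (auto simp: group_of_left_fractions_def hom_def)

lemma \<iota>_mult [simp]:
  "s \<in> carrier S \<Longrightarrow> t \<in> carrier S \<Longrightarrow> \<iota> (s \<otimes>\<^bsub>S\<^esub> t) = \<iota> s \<otimes>\<^bsub>G\<^esub> \<iota> t"
  using fractions by (auto simp: group_of_left_fractions_def hom_def)

lemma \<iota>_one [simp]: "\<iota> \<one>\<^bsub>S\<^esub> = \<one>\<^bsub>G\<^esub>"
proof -
  have "\<iota> \<one>\<^bsub>S\<^esub> \<otimes>\<^bsub>G\<^esub> \<iota> \<one>\<^bsub>S\<^esub> = \<iota> \<one>\<^bsub>S\<^esub>"
    using \<iota>_mult[of "\<one>\<^bsub>S\<^esub>" "\<one>\<^bsub>S\<^esub>"] by simp
  then show ?thesis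
    using G.l_cancel_one[of "\<iota> \<one>\<^bsub>S\<^esub>" "\<iota> \<one>\<^bsub>S\<^esub>"] by simp
qed

lemma \<iota>_inj: "inj_on \<iota> (carrier S)"
  using fractions by (simp add: group_of_left_fractions_def)

lemma fraction_cases:
  assumes "g \<in> carrier G"
  obtains s t where "s \<in> carrier S" "t \<in> carrier S" "g = inv\<^bsub>G\<^esub> (\<iota> s) \<otimes>\<^bsub>G\<^esub> \<iota> t"
  using assms fractions by (auto simp: group_of_left_fractions_def)

text \<open>This is the directedness of the preorder on \<open>G\<close>: the inverse of
  \<open>\<iota> s\<close> is an upper bound of \<open>E\<close>.\<close>

lemma common_denominator:
  assumes "finite E" "E \<subseteq> carrier G"
  shows "\<exists>s\<in>carrier S. \<forall>g\<in>E. \<exists>t\<in>carrier S. g = inv\<^bsub>G\<^esub> (\<iota> s) \<otimes>\<^bsub>G\<^esub> \<iota> t"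
  using assms
proof (induction E rule: finite_induct)
  case empty
  then show ?case
    by (auto intro: bexI[of _ "\<one>\<^bsub>S\<^esub>"])
next
  case (insert g E)
  then obtain s where s: "s \<in> carrier S" "\<forall>h\<in>E. \<exists>t\<in>carrier S. h = inv\<^bsub>G\<^esub> (\<iota> s) \<otimes>\<^bsub>G\<^esub> \<iota> t"
    by auto
  have g: "g \<in> carrier G"
    using insert by simp
  \<comment> \<open>Clearing the denominator \<open>a\<close> of
    \<open>\<iota> s \<otimes> g\<close> makes \<open>a \<otimes> s\<close> a denominator of
    \<open>g\<close>; old numerators \<open>t\<close> become \<open>a \<otimes> t\<close>.\<close>
  obtain a b where ab: "a \<in> carrier S" "b \<in> carrier S" "\<iota> s \<otimes>\<^bsub>G\<^esub> g = inv\<^bsub>G\<^esub> (\<iota> a) \<otimes>\<^bsub>G\<^esub> \<iota> b"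
    using fraction_cases[of "\<iota> s \<otimes>\<^bsub>G\<^esub> g"] g s by auto
  have inv_as: "inv\<^bsub>G\<^esub> (\<iota> (a \<otimes>\<^bsub>S\<^esub> s)) = inv\<^bsub>G\<^esub> (\<iota> s) \<otimes>\<^bsub>G\<^esub> inv\<^bsub>G\<^esub> (\<iota> a)"
    using ab s by (simp add: G.inv_mult_group)
  have "g = inv\<^bsub>G\<^esub> (\<iota> s) \<otimes>\<^bsub>G\<^esub> (\<iota> s \<otimes>\<^bsub>G\<^esub> g)"
    using g s by (simp flip: G.m_assoc)
  then have "g = inv\<^bsub>G\<^esub> (\<iota> (a \<otimes>\<^bsub>S\<^esub> s)) \<otimes>\<^bsub>G\<^esub> \<iota> b"
    unfolding inv_as ab(3) using ab(1,2) s by (simp add: G.m_assoc)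
  moreover have "\<exists>t\<in>carrier S. h = inv\<^bsub>G\<^esub> (\<iota> (a \<otimes>\<^bsub>S\<^esub> s)) \<otimes>\<^bsub>G\<^esub> \<iota> t" if h: "h \<in> E" for h
  proof -
    obtain t where t: "t \<in> carrier S" "h = inv\<^bsub>G\<^esub> (\<iota> s) \<otimes>\<^bsub>G\<^esub> \<iota> t"
      using s h by blast
    have "inv\<^bsub>G\<^esub> (\<iota> (a \<otimes>\<^bsub>S\<^esub> s)) \<otimes>\<^bsub>G\<^esub> \<iota> (a \<otimes>\<^bsub>S\<^esub> t)
        = inv\<^bsub>G\<^esub> (\<iota> s) \<otimes>\<^bsub>G\<^esub> (inv\<^bsub>G\<^esub> (\<iota> a) \<otimes>\<^bsub>G\<^esub> \<iota> a) \<otimes>\<^bsub>G\<^esub> \<iota> t"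
      unfolding inv_as using ab(1) s t(1)
      by (simp only: \<iota>_mult G.m_assoc \<iota>_closed G.inv_closed G.m_closed)
    then have "inv\<^bsub>G\<^esub> (\<iota> (a \<otimes>\<^bsub>S\<^esub> s)) \<otimes>\<^bsub>G\<^esub> \<iota> (a \<otimes>\<^bsub>S\<^esub> t) = h"
      using t ab(1) s by (simp del: \<iota>_mult)
    then show ?thesis
      using t(1) ab(1) by (intro bexI[of _ "a \<otimes>\<^bsub>S\<^esub> t"]) (simp_all del: \<iota>_mult)
  qed
  ultimately show ?case
    using ab s by (intro bexI[of _ "a \<otimes>\<^bsub>S\<^esub> s"]) auto
qed

text \<open>The right fraction of \<open>s\<close> by \<open>t\<close> is rewritten in
  \<open>G\<close> as a left fraction of \<open>b\<close> by \<open>a\<close>; clearing denominators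
  and injectivity of \<iota> bring the identity back to \<open>S\<close>.\<close>

lemma left_ore:
  assumes "s \<in> carrier S" "t \<in> carrier S"
  shows "\<exists>a\<in>carrier S. \<exists>b\<in>carrier S. a \<otimes>\<^bsub>S\<^esub> s = b \<otimes>\<^bsub>S\<^esub> t"
proof -
  obtain a b where ab: "a \<in> carrier S" "b \<in> carrier S"
    "\<iota> s \<otimes>\<^bsub>G\<^esub> inv\<^bsub>G\<^esub> (\<iota> t) = inv\<^bsub>G\<^esub> (\<iota> a) \<otimes>\<^bsub>G\<^esub> \<iota> b"
    using fraction_cases[of "\<iota> s \<otimes>\<^bsub>G\<^esub> inv\<^bsub>G\<^esub> (\<iota> t)"] assms by auto
  have "\<iota> (a \<otimes>\<^bsub>S\<^esub> s) = \<iota> a \<otimes>\<^bsub>G\<^esub> (\<iota> s \<otimes>\<^bsub>G\<^esub> inv\<^bsub>G\<^esub> (\<iota> t)) \<otimes>\<^bsub>G\<^esub> \<iota> t"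
    using ab(1,2) assms by (simp add: G.m_assoc)
  also have "\<dots> = \<iota> (b \<otimes>\<^bsub>S\<^esub> t)"
    unfolding ab(3) using ab(1,2) assms by (simp flip: G.m_assoc)
  finally show ?thesis
    using ab(1,2) assms inj_onD[OF \<iota>_inj] by (metis S.m_closed)
qed

lemma right_folner_embedding:
  assumes \<Phi>: "right_folner S \<Phi>"
  shows "right_folner G (filtermap ((`) \<iota>) \<Phi>)"
proof (rule right_folner_filtermap[OF \<Phi>], goal_cases)
  case (1 F)
  then show ?case
    using inj_on_subset[OF \<iota>_inj] by (auto simp: card_image)
next
  case (2 g)
  then obtain s t where st: "s \<in> carrier S" "t \<in> carrier S" "g = inv\<^bsub>G\<^esub> (\<iota> s) \<otimes>\<^bsub>G\<^esub> \<iota> t"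
    using fraction_cases by blast
  have "card ((\<iota> ` F #>\<^bsub>G\<^esub> g) - \<iota> ` F) \<le> card ((F #>\<^bsub>S\<^esub> s) - F) + card ((F #>\<^bsub>S\<^esub> t) - F)"
    if F: "finite F" "F \<subseteq> carrier S" for F
  proof -
    have fin: "finite (F #>\<^bsub>S\<^esub> s)" "finite (F #>\<^bsub>S\<^esub> t)"
      using F by (auto simp: r_coset_image)
    have "(\<iota> ` F #>\<^bsub>G\<^esub> g) - \<iota> ` F
        \<subseteq> (\<lambda>f. \<iota> f \<otimes>\<^bsub>G\<^esub> g) ` (F - (F #>\<^bsub>S\<^esub> s)) \<union> \<iota> ` ((F #>\<^bsub>S\<^esub> t) - F)"
    proof
      fix y assume y: "y \<in> (\<iota> ` F #>\<^bsub>G\<^esub> g) - \<iota> ` F"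
      then obtain f where f: "f \<in> F" "y = \<iota> f \<otimes>\<^bsub>G\<^esub> g"
        by (auto simp: r_coset_image)
      show "y \<in> (\<lambda>f. \<iota> f \<otimes>\<^bsub>G\<^esub> g) ` (F - (F #>\<^bsub>S\<^esub> s)) \<union> \<iota> ` ((F #>\<^bsub>S\<^esub> t) - F)"
      proof (cases "f \<in> F #>\<^bsub>S\<^esub> s")
        case True
        then obtain f' where f': "f' \<in> F" "f = f' \<otimes>\<^bsub>S\<^esub> s"
          by (auto simp: r_coset_image)
        then have "f' \<in> carrier S"
          using F by blast
        then have "y = \<iota> f' \<otimes>\<^bsub>G\<^esub> (\<iota> s \<otimes>\<^bsub>G\<^esub> inv\<^bsub>G\<^esub> (\<iota> s)) \<otimes>\<^bsub>G\<^esub> \<iota> t"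
          unfolding f f' st(3) using st(1,2)
          by (simp only: \<iota>_mult G.m_assoc \<iota>_closed G.inv_closed G.m_closed)
        then have "y = \<iota> (f' \<otimes>\<^bsub>S\<^esub> t)"
          using \<open>f' \<in> carrier S\<close> st(1,2) by simp
        then show ?thesis
          using y f' by (auto simp: r_coset_image)
      qed (use f in auto)
    qed
    then have "card ((\<iota> ` F #>\<^bsub>G\<^esub> g) - \<iota> ` F)
        \<le> card ((\<lambda>f. \<iota> f \<otimes>\<^bsub>G\<^esub> g) ` (F - (F #>\<^bsub>S\<^esub> s)) \<union> \<iota> ` ((F #>\<^bsub>S\<^esub> t) - F))"
      using F fin by (intro card_mono) auto
    also have "\<dots> \<le> card ((\<lambda>f. \<iota> f \<otimes>\<^bsub>G\<^esub> g) ` (F - (F #>\<^bsub>S\<^esub> s))) + card (\<iota> ` ((F #>\<^bsub>S\<^esub> t) - F))"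
      by (rule card_Un_le)
    also have "\<dots> \<le> card (F - (F #>\<^bsub>S\<^esub> s)) + card ((F #>\<^bsub>S\<^esub> t) - F)"
      using F fin by (intro add_mono card_image_le) auto
    also have "card (F - (F #>\<^bsub>S\<^esub> s)) = card ((F #>\<^bsub>S\<^esub> s) - F)"
      using F st by (intro S.card_diff_r_coset)
    finally show ?thesis .
  qed
  then show ?case
    using st by blast
qed

end

section \<open>The Ore colocalization\<close>

locale ore_colocalization = left_fractions S G \<iota> + compact_action S K \<rho>
  for S :: "('s, 'b) monoid_scheme" and G :: "('g, 'c) monoid_scheme" and \<iota> :: "'s \<Rightarrow> 'g"
    and K :: "'k topology" and \<rho> :: "'s \<Rightarrow> 'k \<Rightarrow> 'k" +
  assumes Hausdorff: "Hausdorff_space K"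
begin

section \<open>The colocalization as a compact space with an action of the group\<close>

abbreviation core :: "'k set" where "core \<equiv> surjective_core S K \<rho>"
abbreviation L :: "('g \<Rightarrow> 'k) topology" where "L \<equiv> ore_coloc_space S G \<iota> K \<rho>"
abbreviation KG :: "('g \<Rightarrow> 'k) topology" where "KG \<equiv> product_topology (\<lambda>_. K) (carrier G)"

lemma continuous_act: "s \<in> carrier S \<Longrightarrow> continuous_map K K (\<rho> s)"
  using action by (simp add: right_action_def)

lemma core_subset: "core \<subseteq> topspace K"
  using act_one by (force simp: surjective_core_def)

text \<open>Coordinates of compatible threads lie in the core automatically: for every
  \<open>s\<close>, the coordinate at \<open>g\<close> is the image under \<open>\<rho> s\<close> of
  the one at \<open>g \<otimes> inv (\<iota> s)\<close>.\<close>

lemma topspace_coloc: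
  "topspace L = {x \<in> carrier G \<rightarrow>\<^sub>E topspace K.
     \<forall>g\<in>carrier G. \<forall>s\<in>carrier S. x (g \<otimes>\<^bsub>G\<^esub> \<iota> s) = \<rho> s (x g)}" (is "_ = ?R")
proof -
  have "x g \<in> core" if x: "x \<in> ?R" and g: "g \<in> carrier G" for x g
    unfolding surjective_core_def
  proof
    fix s assume s: "s \<in> carrier S"
    let ?h = "g \<otimes>\<^bsub>G\<^esub> inv\<^bsub>G\<^esub> (\<iota> s)"
    have h: "?h \<in> carrier G" "?h \<otimes>\<^bsub>G\<^esub> \<iota> s = g"
      using g s by (auto simp: G.m_assoc)
    have "x (?h \<otimes>\<^bsub>G\<^esub> \<iota> s) = \<rho> s (x ?h)"
      using x h s by blast
    moreover have "x ?h \<in> topspace K"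
      using x h by blast
    ultimately show "x g \<in> \<rho> s ` topspace K"
      using h(2) by force
  qed
  then have "?R \<subseteq> (carrier G \<rightarrow>\<^sub>E topspace K \<inter> core)"
    by (intro subsetI PiE_I) (auto simp: PiE_iff extensional_def)
  then show ?thesis
    unfolding ore_coloc_space_def topspace_subtopology topspace_product_topology by blast
qed

lemma coloc_eq_subtopology: "L = subtopology KG (topspace L)"
proof -
  let ?T = "{x. \<forall>g\<in>carrier G. \<forall>s\<in>carrier S. x (g \<otimes>\<^bsub>G\<^esub> \<iota> s) = \<rho> s (x g)}"
  have eq: "L = subtopology KG ((carrier G \<rightarrow>\<^sub>E core) \<inter> ?T)"
    by (simp add: ore_coloc_space_def subtopology_subtopology flip: subtopology_product_topology)
  have top: "topspace L = topspace KG \<inter> ((carrier G \<rightarrow>\<^sub>E core) \<inter> ?T)"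
    unfolding eq by (rule topspace_subtopology)
  have "subtopology KG (topspace L) = L"
    unfolding top subtopology_restrict by (rule eq[symmetric])
  then show ?thesis
    by simp
qed

lemma coloc_closed: "x \<in> topspace L \<Longrightarrow> g \<in> carrier G \<Longrightarrow> x g \<in> topspace K"
  by (auto simp: topspace_coloc)

lemma coloc_compat:
  "x \<in> topspace L \<Longrightarrow> g \<in> carrier G \<Longrightarrow> s \<in> carrier S \<Longrightarrow> x (g \<otimes>\<^bsub>G\<^esub> \<iota> s) = \<rho> s (x g)"
  by (auto simp: topspace_coloc)

lemma closedin_compat:
  assumes "g \<in> carrier G" "s \<in> carrier S"
  shows "closedin KG {x \<in> topspace KG. x (g \<otimes>\<^bsub>G\<^esub> \<iota> s) = \<rho> s (x g)}"
proof (rule closedin_continuous_maps_eq[OF Hausdorff])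
  show "continuous_map KG K (\<lambda>x. x (g \<otimes>\<^bsub>G\<^esub> \<iota> s))"
    using assms by (intro continuous_map_product_projection) auto
  show "continuous_map KG K (\<lambda>x. \<rho> s (x g))"
    using continuous_map_compose[OF continuous_map_product_projection[OF assms(1)] continuous_act[OF assms(2)]]
    by (simp add: o_def)
qed

lemma compact_KG: "compact_space KG"
  using compact by (simp add: compact_space_product_topology)

text \<open>Each compatibility condition equates two continuous maps into a Hausdorff space, so the
  threads form a closed subset of a compact product.\<close>

lemma compact_coloc: "compact_space L"
proof -
  have "topspace L = (\<Inter>g\<in>carrier G. \<Inter>s\<in>carrier S. {x \<in> topspace KG. x (g \<otimes>\<^bsub>G\<^esub> \<iota> s) = \<rho> s (x g)})"
    using G.one_closed S.one_closed unfolding topspace_coloc topspace_product_topology by blast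
  also have "closedin KG \<dots>"
    using G.one_closed S.one_closed by (intro closedin_INT closedin_compat) auto
  finally have "compactin KG (topspace L)"
    by (rule closedin_compact_space[OF compact_KG])
  then show ?thesis
    by (subst coloc_eq_subtopology) (rule compact_space_subtopology)
qed

lemma continuous_eval:
  assumes "g \<in> carrier G" shows "continuous_map L K (\<lambda>x. x g)"
  by (subst coloc_eq_subtopology)
    (intro continuous_map_from_subtopology continuous_map_product_projection assms)

lemma coloc_action_apply: "h \<in> carrier G \<Longrightarrow> ore_coloc_action G g x h = x (g \<otimes>\<^bsub>G\<^esub> h)"
  by (simp add: ore_coloc_action_def)

lemma coloc_action_closed:
  "g \<in> carrier G \<Longrightarrow> x \<in> topspace L \<Longrightarrow> ore_coloc_action G g x \<in> topspace L"
  unfolding topspace_coloc by (auto simp: ore_coloc_action_def G.m_assoc[symmetric])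

lemma compact_action_coloc: "compact_action G L (ore_coloc_action G)"
proof unfold_locales
  show "compact_space L"
    by (rule compact_coloc)
  show "right_action G L (ore_coloc_action G)"
    unfolding right_action_def
  proof (intro conjI ballI)
    fix g assume g: "g \<in> carrier G"
    have "continuous_map L KG (ore_coloc_action G g)"
      unfolding continuous_map_componentwise
      using g by (auto simp: coloc_action_apply ore_coloc_action_def intro: continuous_eval)
    then have "continuous_map L (subtopology KG (topspace L)) (ore_coloc_action G g)"
      using coloc_action_closed[OF g] by (auto simp: continuous_map_in_subtopology)
    then show "continuous_map L L (ore_coloc_action G g)"
      using coloc_eq_subtopology by simp
  next
    fix x assume "x \<in> topspace L"
    then show "ore_coloc_action G \<one>\<^bsub>G\<^esub> x = x"
      by (auto simp: topspace_coloc ore_coloc_action_def PiE_iff extensional_def fun_eq_iff)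
  next
    fix g h x assume "g \<in> carrier G" "h \<in> carrier G"
    then show "ore_coloc_action G (g \<otimes>\<^bsub>G\<^esub> h) x = ore_coloc_action G h (ore_coloc_action G g x)"
      by (auto simp: ore_coloc_action_def fun_eq_iff G.m_assoc)
  qed
qed

section \<open>The surjective core: approximation by images and lifting of points\<close>

text \<open>The left Ore condition makes the images directed downwards: if
  \<open>a \<otimes> c = b \<otimes> t\<close>, the image under this product lies in those of
  \<open>\<rho> c\<close> and \<open>\<rho> t\<close>.\<close>

lemma core_dominated:
  assumes "finite T" "T \<subseteq> carrier S"
  shows "\<exists>c\<in>carrier S. \<forall>t\<in>T. \<rho> c ` topspace K \<subseteq> \<rho> t ` topspace K"
  using assms
proof (induction T rule: finite_induct)
  case (insert t T)
  then obtain c where c: "c \<in> carrier S" "\<forall>t\<in>T. \<rho> c ` topspace K \<subseteq> \<rho> t ` topspace K"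
    by auto
  obtain a b where ab: "a \<in> carrier S" "b \<in> carrier S" "a \<otimes>\<^bsub>S\<^esub> c = b \<otimes>\<^bsub>S\<^esub> t"
    using left_ore[of c t] c insert.prems by auto
  have "\<rho> (a \<otimes>\<^bsub>S\<^esub> c) ` topspace K \<subseteq> \<rho> c ` topspace K"
    using ab(1) c(1) by (auto simp: act_mult act_closed)
  moreover have "\<rho> (b \<otimes>\<^bsub>S\<^esub> t) ` topspace K \<subseteq> \<rho> t ` topspace K"
    using ab(2) insert.prems by (auto simp: act_mult act_closed)
  ultimately have "\<forall>t\<in>insert t T. \<rho> (a \<otimes>\<^bsub>S\<^esub> c) ` topspace K \<subseteq> \<rho> t ` topspace K"
    using c(2) unfolding ab(3) by blast
  then show ?case
    using ab(1) c(1) by (intro bexI[of _ "a \<otimes>\<^bsub>S\<^esub> c"]) auto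
qed (auto intro: bexI[of _ "\<one>\<^bsub>S\<^esub>"])

lemma closedin_act_image: "t \<in> carrier S \<Longrightarrow> closedin K (\<rho> t ` topspace K)"
  using compactin_imp_closedin[OF Hausdorff image_compactin[OF _ continuous_act]] compact
  by (simp add: compact_space_def)

lemma closedin_core: "closedin K core"
  unfolding surjective_core_def using S.one_closed by (intro closedin_INT closedin_act_image) auto

text \<open>\<open>V\<close> and the complements of the images cover \<open>K\<close>. A finite
  subcover uses finitely many images, and an image inside all of them must lie in
  \<open>V\<close>.\<close>

lemma core_neighbourhood_contains_image:
  assumes O: "openin K V" "core \<subseteq> V"
  shows "\<exists>c\<in>carrier S. \<rho> c ` topspace K \<subseteq> V"
proof -
  let ?\<C> = "insert V ((\<lambda>t. topspace K - \<rho> t ` topspace K) ` carrier S)"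
  have "\<exists>\<F>. finite \<F> \<and> \<F> \<subseteq> ?\<C> \<and> topspace K \<subseteq> \<Union>\<F>"
  proof (rule compact[unfolded compact_space_alt, rule_format], intro conjI ballI)
    show "openin K U" if "U \<in> ?\<C>" for U
      using that O closedin_act_image by auto
    show "topspace K \<subseteq> \<Union>?\<C>"
      using O(2) by (auto simp: surjective_core_def)
  qed
  then obtain \<F> where F: "finite \<F>" "\<F> \<subseteq> ?\<C>" "topspace K \<subseteq> \<Union>\<F>"
    by blast
  have "\<F> - {V} \<subseteq> (\<lambda>t. topspace K - \<rho> t ` topspace K) ` carrier S"
    using F(2) by auto
  then obtain T where T: "T \<subseteq> carrier S" "finite T" "\<F> - {V} = (\<lambda>t. topspace K - \<rho> t ` topspace K) ` T"
    using finite_subset_image[of "\<F> - {V}"] F(1) by (metis finite_Diff)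
  obtain c where c: "c \<in> carrier S" "\<forall>t\<in>T. \<rho> c ` topspace K \<subseteq> \<rho> t ` topspace K"
    using core_dominated[OF T(2,1)] by blast
  have "\<rho> c ` topspace K \<subseteq> V"
  proof
    fix y assume y: "y \<in> \<rho> c ` topspace K"
    then have "y \<in> topspace K"
      using c(1) act_closed by auto
    then obtain U where "U \<in> \<F>" "y \<in> U"
      using F(3) by blast
    moreover have "y \<notin> U" if "U \<in> \<F> - {V}" for U
      using that y c(2) unfolding T(3) by auto
    ultimately show "y \<in> V"
      by blast
  qed
  then show ?thesis
    using c(1) by blast
qed

text \<open>A thread through \<open>x\<close> is found by the finite intersection property; common
  denominators reduce finitely many partial compatibility conditions to one, which a preimage of
  \<open>x\<close> satisfies.\<close>

lemma projection_onto_core: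
  assumes x: "x \<in> core"
  shows "\<exists>y\<in>topspace L. y \<one>\<^bsub>G\<^esub> = x"
proof -
  let ?i = "\<lambda>t. inv\<^bsub>G\<^esub> (\<iota> t)"
  have xK: "x \<in> topspace K"
    using x core_subset by blast
  \<comment> \<open>The threads through \<open>x\<close> that are only required to be compatible on the cone \<open>t\<^sup>-\<^sup>1S\<close>.\<close>
  define C where "C = (\<lambda>t. {y \<in> topspace KG. y \<one>\<^bsub>G\<^esub> = x \<and>
    (\<forall>s\<in>carrier S. y (?i t \<otimes>\<^bsub>G\<^esub> \<iota> s) = \<rho> s (y (?i t)))})"
  have closed: "closedin KG (C t)" if t: "t \<in> carrier S" for t
  proof -
    have "continuous_map KG K (\<lambda>y. y \<one>\<^bsub>G\<^esub>)"
      by (intro continuous_map_product_projection) simp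
    then have 1: "closedin KG {y \<in> topspace KG. y \<one>\<^bsub>G\<^esub> = x}"
      using xK by (intro closedin_continuous_maps_eq[OF Hausdorff]) auto
    have 2: "closedin KG (\<Inter>s\<in>carrier S. {y \<in> topspace KG. y (?i t \<otimes>\<^bsub>G\<^esub> \<iota> s) = \<rho> s (y (?i t))})"
      using t S.one_closed by (intro closedin_INT closedin_compat) auto
    have "C t = {y \<in> topspace KG. y \<one>\<^bsub>G\<^esub> = x} \<inter>
        (\<Inter>s\<in>carrier S. {y \<in> topspace KG. y (?i t \<otimes>\<^bsub>G\<^esub> \<iota> s) = \<rho> s (y (?i t))})"
      unfolding C_def by blast
    then show ?thesis
      using closedin_Int[OF 1 2] by simp
  qed
  have nonempty: "C t \<noteq> {}" if t: "t \<in> carrier S" for t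
  proof -
    obtain z where z: "z \<in> topspace K" "x = \<rho> t z"
      using x t by (auto simp: surjective_core_def)
    \<comment> \<open>The thread has value \<open>z\<close> at the vertex of the cone and follows
      the action along it. Off the cone its values are unconstrained, and \<open>z\<close> is
      used.\<close>
    define y where "y = (\<lambda>g\<in>carrier G. if \<iota> t \<otimes>\<^bsub>G\<^esub> g \<in> \<iota> ` carrier S
      then \<rho> (the_inv_into (carrier S) \<iota> (\<iota> t \<otimes>\<^bsub>G\<^esub> g)) z else z)"
    have y: "y (?i t \<otimes>\<^bsub>G\<^esub> \<iota> s) = \<rho> s z" if "s \<in> carrier S" for s
    proof -
      have "\<iota> t \<otimes>\<^bsub>G\<^esub> (?i t \<otimes>\<^bsub>G\<^esub> \<iota> s) = \<iota> s"
        using t that by (simp flip: G.m_assoc)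
      then show ?thesis
        using t that the_inv_into_f_f[OF \<iota>_inj that] by (simp add: y_def)
    qed
    have "y \<in> topspace KG"
      using z act_closed the_inv_into_f_f[OF \<iota>_inj] by (auto simp: y_def)
    moreover have "y \<one>\<^bsub>G\<^esub> = x"
      using y[OF t] t z by simp
    moreover have "y (?i t) = z"
      using y[OF S.one_closed] t z act_one by simp
    ultimately have "y \<in> C t"
      using y by (simp add: C_def)
    then show ?thesis
      by blast
  qed
  \<comment> \<open>Here the cone at the inverse of \<open>t\<close> is contained in the cone at the
    inverse of \<open>s\<close>, and compatibility passes to the smaller cone.\<close>
  have mono: "C s \<subseteq> C t" if st: "s \<in> carrier S" "t \<in> carrier S" "a \<in> carrier S" "?i t = ?i s \<otimes>\<^bsub>G\<^esub> \<iota> a" for s t a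
  proof
    fix y assume y: "y \<in> C s"
    have "y (?i t \<otimes>\<^bsub>G\<^esub> \<iota> r) = \<rho> r (y (?i t))" if r: "r \<in> carrier S" for r
    proof -
      have "?i t \<otimes>\<^bsub>G\<^esub> \<iota> r = ?i s \<otimes>\<^bsub>G\<^esub> \<iota> (a \<otimes>\<^bsub>S\<^esub> r)"
        unfolding st(4) using st(1-3) r by (simp add: G.m_assoc)
      then have "y (?i t \<otimes>\<^bsub>G\<^esub> \<iota> r) = \<rho> (a \<otimes>\<^bsub>S\<^esub> r) (y (?i s))"
        using y st r by (simp add: C_def del: \<iota>_mult)
      also have "\<dots> = \<rho> r (\<rho> a (y (?i s)))"
        using y st(1,3) r by (intro act_mult) (auto simp: C_def)
      also have "\<rho> a (y (?i s)) = y (?i t)"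
        unfolding st(4) using y st(3) by (simp add: C_def)
      finally show ?thesis .
    qed
    then show "y \<in> C t"
      using y by (simp add: C_def)
  qed
  have "\<Inter>(C ` carrier S) \<noteq> {}"
  proof (rule compact_KG[unfolded compact_space_fip, rule_format], intro conjI ballI allI impI)
    show "closedin KG D" if "D \<in> C ` carrier S" for D
      using that closed by blast
    fix \<F> assume "finite \<F> \<and> \<F> \<subseteq> C ` carrier S"
    then obtain T where T: "T \<subseteq> carrier S" "finite T" "\<F> = C ` T"
      using finite_subset_image by metis
    have "finite (?i ` T)" "?i ` T \<subseteq> carrier G"
      using T by auto
    then obtain s where s: "s \<in> carrier S" "\<forall>g\<in>?i ` T. \<exists>a\<in>carrier S. g = ?i s \<otimes>\<^bsub>G\<^esub> \<iota> a"
      using common_denominator by blast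
    have "C s \<subseteq> \<Inter>\<F>"
      using s mono[OF s(1)] T by blast
    then show "\<Inter>\<F> \<noteq> {}"
      using nonempty[OF s(1)] by blast
  qed
  then obtain y where y: "\<And>t. t \<in> carrier S \<Longrightarrow> y \<in> C t"
    by blast
  \<comment> \<open>Every \<open>g\<close> lies on one of the cones, so the conditions for all
    \<open>t\<close> together give full compatibility.\<close>
  have "y (g \<otimes>\<^bsub>G\<^esub> \<iota> s) = \<rho> s (y g)" if g: "g \<in> carrier G" and s: "s \<in> carrier S" for g s
  proof -
    obtain t a where ta: "t \<in> carrier S" "a \<in> carrier S" "g = ?i t \<otimes>\<^bsub>G\<^esub> \<iota> a"
      using fraction_cases[OF g] by blast
    have "y (?i t) \<in> topspace K"
      using y[OF ta(1)] ta(1) by (auto simp: C_def)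
    moreover have "g \<otimes>\<^bsub>G\<^esub> \<iota> s = ?i t \<otimes>\<^bsub>G\<^esub> \<iota> (a \<otimes>\<^bsub>S\<^esub> s)"
      using ta s by (simp add: G.m_assoc)
    ultimately show ?thesis
      using y[OF ta(1)] ta s by (simp add: C_def act_mult del: \<iota>_mult)
  qed
  moreover have "y \<in> topspace KG" "y \<one>\<^bsub>G\<^esub> = x"
    using y[OF S.one_closed] by (auto simp: C_def)
  ultimately show ?thesis
    by (intro bexI[of _ y]) (auto simp: topspace_coloc)
qed

section \<open>Covers pulled back along the projection at the identity\<close>

definition pullback :: "'k set \<Rightarrow> ('g \<Rightarrow> 'k) set" where
  "pullback U = {x \<in> topspace L. x \<one>\<^bsub>G\<^esub> \<in> U}"

lemma open_cover_pullback:
  assumes "open_cover K \<U>"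
  shows "open_cover L (pullback ` \<U>)"
  unfolding open_cover_def
proof (intro conjI ballI)
  fix P assume "P \<in> pullback ` \<U>"
  then show "openin L P"
    using assms openin_continuous_map_preimage[OF continuous_eval[OF G.one_closed]]
    by (auto simp: pullback_def open_cover_def)
next
  show "\<Union>(pullback ` \<U>) = topspace L"
    using assms coloc_closed[OF _ G.one_closed] by (fastforce simp: pullback_def open_cover_def)
qed

lemma coloc_act_one: "s \<in> carrier S \<Longrightarrow> x \<in> topspace L \<Longrightarrow> ore_coloc_action G (\<iota> s) x \<one>\<^bsub>G\<^esub> = \<rho> s (x \<one>\<^bsub>G\<^esub>)"
  using coloc_compat[of x "\<one>\<^bsub>G\<^esub>" s] by (simp add: coloc_action_apply)

text \<open>The projection at the identity intertwines the action of \<open>\<iota> s\<close> with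
  \<open>\<rho> s\<close>, so words on \<open>K\<close> pull back to words on
  \<open>L\<close>.\<close>

lemma cover_number_pullback_le:
  assumes U: "open_cover K \<U>" and F: "finite F" "F \<subseteq> carrier S" "F \<noteq> {}"
  shows "cover_number L (joined_cover L (ore_coloc_action G) (pullback ` \<U>) (\<iota> ` F))
    \<le> cover_number K (joined_cover K \<rho> \<U> F)"
proof (rule cover_number_joined_mono_compact[OF U F, where \<psi> = "\<lambda>u. pullback \<circ> u \<circ> the_inv_into (carrier S) \<iota>"])
  let ?\<psi> = "\<lambda>u. pullback \<circ> u \<circ> the_inv_into (carrier S) \<iota>"
  have \<psi>: "?\<psi> u (\<iota> s) = pullback (u s)" if "s \<in> F" for u s
    using the_inv_into_f_f[OF \<iota>_inj] that F by auto
  fix A assume A: "covering_words K \<rho> \<U> F A"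
  show "covering_words L (ore_coloc_action G) (pullback ` \<U>) (\<iota> ` F) (?\<psi> ` A)"
    unfolding covering_words_def
  proof (intro conjI ballI)
    show "finite (?\<psi> ` A)"
      using A by (simp add: covering_words_def)
    show "?\<psi> ` A \<subseteq> \<iota> ` F \<rightarrow> pullback ` \<U>"
    proof clarify
      fix u s assume "u \<in> A" "s \<in> F"
      then show "?\<psi> u (\<iota> s) \<in> pullback ` \<U>"
        using A unfolding \<psi>[OF \<open>s \<in> F\<close>] by (auto simp: covering_words_def)
    qed
    fix x assume x: "x \<in> topspace L"
    then obtain u where u: "u \<in> A" "\<forall>s\<in>F. \<rho> s (x \<one>\<^bsub>G\<^esub>) \<in> u s"
      using A coloc_closed[OF x G.one_closed] by (auto simp: covering_words_def)
    have "ore_coloc_action G (\<iota> s) x \<in> ?\<psi> u (\<iota> s)" if s: "s \<in> F" for s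
    proof -
      have "s \<in> carrier S"
        using s F by blast
      then show ?thesis
        using x u s coloc_action_closed[OF _ x] unfolding \<psi>[OF s] by (simp add: pullback_def coloc_act_one)
    qed
    then show "\<exists>v\<in>?\<psi> ` A. \<forall>g\<in>\<iota> ` F. ore_coloc_action G g x \<in> v g"
      using u(1) by blast
  qed
qed (use F in auto)

lemma cover_number_translate_le_pullback:
  assumes U: "open_cover K \<U>" and F: "finite F" "F \<subseteq> carrier S" "F \<noteq> {}"
  shows "\<exists>c\<in>carrier S. cover_number K (joined_cover K \<rho> \<U> ((\<otimes>\<^bsub>S\<^esub>) c ` F))
    \<le> cover_number L (joined_cover L (ore_coloc_action G) (pullback ` \<U>) (\<iota> ` F))"
proof -
  interpret coloc: compact_action G L "ore_coloc_action G"
    by (rule compact_action_coloc)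
  have \<iota>F: "finite (\<iota> ` F)" "\<iota> ` F \<subseteq> carrier G" "\<iota> ` F \<noteq> {}"
    using F by auto
  obtain B where "covering_words L (ore_coloc_action G) (pullback ` \<U>) (\<iota> ` F) B"
    using G.covering_words_exist[OF compact_coloc coloc.action open_cover_pullback[OF U] \<iota>F(1,2)] by blast
  then obtain A where A: "covering_words L (ore_coloc_action G) (pullback ` \<U>) (\<iota> ` F) A"
    "card A = cover_number L (joined_cover L (ore_coloc_action G) (pullback ` \<U>) (\<iota> ` F))"
    using cover_number_joined_attained[OF _ \<iota>F(3)] by blast
  have "\<forall>P\<in>pullback ` \<U>. \<exists>U. U \<in> \<U> \<and> P = pullback U"
    by blast
  \<comment> \<open>Different members of \<U> may have the same pullback, so one of them is
    chosen.\<close>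
  then obtain q where q: "\<And>P. P \<in> pullback ` \<U> \<Longrightarrow> q P \<in> \<U> \<and> P = pullback (q P)"
    by metis
  have word: "w (\<iota> s) \<in> pullback ` \<U>" if "w \<in> A" "s \<in> F" for w s
    using A(1) that by (auto simp: covering_words_def)
  define V where "V = (\<Union>w\<in>A. {y \<in> topspace K. \<forall>s\<in>F. \<rho> s y \<in> q (w (\<iota> s))})"
  have "openin K V"
    unfolding V_def
  proof (intro openin_Union ballI, elim imageE, hypsubst)
    fix w assume w: "w \<in> A"
    have "openin K {y \<in> topspace K. \<rho> s y \<in> q (w (\<iota> s))}" if s: "s \<in> F" for s
    proof (rule openin_continuous_map_preimage[OF continuous_act])
      show "s \<in> carrier S"
        using s F by blast
      show "openin K (q (w (\<iota> s)))"
        using q[OF word[OF w s]] U by (auto simp: open_cover_def)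
    qed
    then have "openin K (\<Inter>s\<in>F. {y \<in> topspace K. \<rho> s y \<in> q (w (\<iota> s))})"
      using F by (intro openin_INT2) auto
    moreover have "(\<Inter>s\<in>F. {y \<in> topspace K. \<rho> s y \<in> q (w (\<iota> s))})
        = {y \<in> topspace K. \<forall>s\<in>F. \<rho> s y \<in> q (w (\<iota> s))}"
      using F by auto
    ultimately show "openin K {y \<in> topspace K. \<forall>s\<in>F. \<rho> s y \<in> q (w (\<iota> s))}"
      by simp
  qed
  moreover have "core \<subseteq> V"
  proof
    fix y assume y: "y \<in> core"
    then obtain x where x: "x \<in> topspace L" "x \<one>\<^bsub>G\<^esub> = y"
      using projection_onto_core by blast
    obtain w where w: "w \<in> A" "\<forall>g\<in>\<iota> ` F. ore_coloc_action G g x \<in> w g"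
      using A(1) x(1) by (auto simp: covering_words_def)
    have "\<rho> s y \<in> q (w (\<iota> s))" if s: "s \<in> F" for s
    proof -
      have "ore_coloc_action G (\<iota> s) x \<in> pullback (q (w (\<iota> s)))"
        using w s q[OF word[OF w(1) s]] by auto
      then show ?thesis
        using x s F coloc_act_one[of s x] by (auto simp: pullback_def)
    qed
    then show "y \<in> V"
      using w(1) y core_subset by (auto simp: V_def)
  qed
  ultimately obtain c where c: "c \<in> carrier S" "\<rho> c ` topspace K \<subseteq> V"
    using core_neighbourhood_contains_image by blast
  define \<psi> where "\<psi> = (\<lambda>w t. q (w (\<iota> (the_inv_into F ((\<otimes>\<^bsub>S\<^esub>) c) t))))"
  have \<psi>_apply: "\<psi> w (c \<otimes>\<^bsub>S\<^esub> s) = q (w (\<iota> s))" if "s \<in> F" for w s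
    using the_inv_into_f_f[OF S.inj_on_l_mult[OF c(1) F(2)] that] by (simp add: \<psi>_def)
  have "covering_words K \<rho> \<U> ((\<otimes>\<^bsub>S\<^esub>) c ` F) (\<psi> ` A)"
    unfolding covering_words_def
  proof (intro conjI ballI)
    show "finite (\<psi> ` A)"
      using A(1) by (simp add: covering_words_def)
    show "\<psi> ` A \<subseteq> (\<otimes>\<^bsub>S\<^esub>) c ` F \<rightarrow> \<U>"
    proof clarify
      fix w s assume "w \<in> A" "s \<in> F"
      then show "\<psi> w (c \<otimes>\<^bsub>S\<^esub> s) \<in> \<U>"
        using q[OF word] unfolding \<psi>_apply[OF \<open>s \<in> F\<close>] by blast
    qed
    fix x assume x: "x \<in> topspace K"
    then obtain w where w: "w \<in> A" "\<forall>s\<in>F. \<rho> s (\<rho> c x) \<in> q (w (\<iota> s))"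
      using c(2) by (force simp: V_def)
    have "\<rho> (c \<otimes>\<^bsub>S\<^esub> s) x \<in> \<psi> w (c \<otimes>\<^bsub>S\<^esub> s)" if s: "s \<in> F" for s
      using w s F c(1) x unfolding \<psi>_apply[OF s] by (auto simp: act_mult)
    then show "\<exists>v\<in>\<psi> ` A. \<forall>t\<in>(\<otimes>\<^bsub>S\<^esub>) c ` F. \<rho> t x \<in> v t"
      using w(1) by blast
  qed
  then have "cover_number K (joined_cover K \<rho> \<U> ((\<otimes>\<^bsub>S\<^esub>) c ` F)) \<le> card (\<psi> ` A)"
    using F by (intro cover_number_joined_le) auto
  also have "\<dots> \<le> card A"
    using A(1) by (intro card_image_le) (auto simp: covering_words_def)
  finally show ?thesis
    using c(1) A(2) by auto
qed

lemma cover_entropy_pullback: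
  assumes U: "open_cover K \<U>" and \<Phi>: "right_folner S \<Phi>"
  shows "cover_entropy S K \<rho> \<U> = cover_entropy G L (ore_coloc_action G) (pullback ` \<U>)"
proof (rule antisym)
  have good: "\<forall>\<^sub>F F in \<Phi>. finite F \<and> F \<noteq> {} \<and> F \<subseteq> carrier S"
    using \<Phi> by (simp add: right_folner_def)
  have actS: "compact_action S K \<rho>"
    by (rule compact_action_axioms)
  \<comment> \<open>The guard makes a choice of \<open>c\<close> possible for every
    \<open>F\<close>, as left translation of the net asks for \<open>c F\<close> in the carrier
    without exception.\<close>
  define Q where "Q = (\<lambda>F c. finite F \<and> F \<noteq> {} \<and> F \<subseteq> carrier S \<longrightarrow>
    cover_number K (joined_cover K \<rho> \<U> ((\<otimes>\<^bsub>S\<^esub>) c ` F))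
      \<le> cover_number L (joined_cover L (ore_coloc_action G) (pullback ` \<U>) (\<iota> ` F)))"
  have "\<exists>c\<in>carrier S. Q F c" for F
  proof (cases "finite F \<and> F \<noteq> {} \<and> F \<subseteq> carrier S")
    case True
    then show ?thesis
      using cover_number_translate_le_pullback[OF U, of F] by (simp add: Q_def)
  next
    case False
    then have "Q F \<one>\<^bsub>S\<^esub>"
      unfolding Q_def by blast
    then show ?thesis
      using S.one_closed by blast
  qed
  then obtain c where c: "\<And>F. c F \<in> carrier S" "\<And>F. Q F (c F)"
    by metis
  show "cover_entropy S K \<rho> \<U> \<le> cover_entropy G L (ore_coloc_action G) (pullback ` \<U>)"
  proof (rule cover_entropy_le_along[OF actS compact_action_coloc U open_cover_pullback[OF U]])
    show "right_folner S (filtermap (\<lambda>F. (\<otimes>\<^bsub>S\<^esub>) (c F) ` F) \<Phi>)"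
      by (rule S.right_folner_left_translates[OF \<Phi> c(1)])
    show "right_folner G (filtermap ((`) \<iota>) \<Phi>)"
      by (rule right_folner_embedding[OF \<Phi>])
    show "\<forall>\<^sub>F F in \<Phi>. card ((\<otimes>\<^bsub>S\<^esub>) (c F) ` F) = card (\<iota> ` F) \<and>
      cover_number K (joined_cover K \<rho> \<U> ((\<otimes>\<^bsub>S\<^esub>) (c F) ` F))
        \<le> cover_number L (joined_cover L (ore_coloc_action G) (pullback ` \<U>) (\<iota> ` F))"
      using good
    proof eventually_elim
      case (elim F)
      then show ?case
        using c(1)[of F] c(2)[of F, unfolded Q_def] S.card_l_mult_image[of "c F" F] card_image[OF inj_on_subset[OF \<iota>_inj]] by simp
    qed
  qed
  show "cover_entropy G L (ore_coloc_action G) (pullback ` \<U>) \<le> cover_entropy S K \<rho> \<U>"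
  proof (rule cover_entropy_le_along[OF compact_action_coloc actS open_cover_pullback[OF U] U])
    show "right_folner G (filtermap ((`) \<iota>) \<Phi>)"
      by (rule right_folner_embedding[OF \<Phi>])
    show "right_folner S (filtermap (\<lambda>F. F) \<Phi>)"
      using \<Phi> by (simp add: filtermap_ident)
    show "\<forall>\<^sub>F F in \<Phi>. card (\<iota> ` F) = card F \<and>
      cover_number L (joined_cover L (ore_coloc_action G) (pullback ` \<U>) (\<iota> ` F))
        \<le> cover_number K (joined_cover K \<rho> \<U> F)"
      using good
    proof eventually_elim
      case (elim F)
      then show ?case
        using cover_number_pullback_le[OF U] card_image[OF inj_on_subset[OF \<iota>_inj]] by simp
    qed
  qed
qed

section \<open>Reduction of arbitrary covers to pullbacks\<close>

text \<open>A basic open set of the product restricts finitely many coordinates; for a thread these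
  are all determined by the coordinate at the inverse of a common denominator.\<close>

lemma basic_neighbourhood:
  assumes W: "openin L W" and x: "x \<in> W"
  shows "\<exists>g\<in>carrier G. \<exists>V. openin K V \<and> x g \<in> V \<and> (\<forall>y\<in>topspace L. y g \<in> V \<longrightarrow> y \<in> W)"
proof -
  obtain D where D: "openin KG D" "W = D \<inter> topspace L"
    using W by (subst (asm) coloc_eq_subtopology) (auto simp: openin_subtopology)
  then obtain B where B: "finite {i \<in> carrier G. B i \<noteq> topspace K}" "\<forall>i\<in>carrier G. openin K (B i)"
    "x \<in> Pi\<^sub>E (carrier G) B" "Pi\<^sub>E (carrier G) B \<subseteq> D"
    using x unfolding openin_product_topology_alt by blast
  have xL: "x \<in> topspace L"
    using x D(2) by blast
  define J where "J = {i \<in> carrier G. B i \<noteq> topspace K}"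
  have "finite J" "J \<subseteq> carrier G"
    using B(1) by (auto simp: J_def)
  then obtain s where s: "s \<in> carrier S" "\<forall>j\<in>J. \<exists>t\<in>carrier S. j = inv\<^bsub>G\<^esub> (\<iota> s) \<otimes>\<^bsub>G\<^esub> \<iota> t"
    using common_denominator by blast
  then obtain t where t: "\<And>j. j \<in> J \<Longrightarrow> t j \<in> carrier S \<and> j = inv\<^bsub>G\<^esub> (\<iota> s) \<otimes>\<^bsub>G\<^esub> \<iota> (t j)"
    by metis
  let ?g = "inv\<^bsub>G\<^esub> (\<iota> s)"
  have g: "?g \<in> carrier G"
    using s(1) by simp
  have eval: "y j = \<rho> (t j) (y ?g)" if "y \<in> topspace L" "j \<in> J" for y j
    using coloc_compat[OF that(1) g, of "t j"] t[OF that(2)] by simp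
  \<comment> \<open>The factor \<open>topspace K\<close> gives the right set when no coordinate is
    restricted.\<close>
  define V where "V = topspace K \<inter> (\<Inter>j\<in>J. {z \<in> topspace K. \<rho> (t j) z \<in> B j})"
  have "openin K V"
  proof (cases "J = {}")
    case False
    have "openin K (\<Inter>j\<in>J. {z \<in> topspace K. \<rho> (t j) z \<in> B j})"
    proof (rule openin_INT2)
      fix j assume j: "j \<in> J"
      then show "openin K {z \<in> topspace K. \<rho> (t j) z \<in> B j}"
        using B(2) t[OF j] by (intro openin_continuous_map_preimage[OF continuous_act]) (auto simp: J_def)
    qed (use \<open>finite J\<close> False in auto)
    then show ?thesis
      unfolding V_def by (intro openin_Int openin_topspace)
  qed (simp add: V_def)
  moreover have "x ?g \<in> V"
    using B(3) coloc_closed[OF xL g] \<open>J \<subseteq> carrier G\<close> by (auto simp: V_def PiE_iff simp flip: eval[OF xL])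
  moreover have "y \<in> W" if y: "y \<in> topspace L" "y ?g \<in> V" for y
  proof -
    have "y j \<in> B j" if "j \<in> carrier G" for j
    proof (cases "j \<in> J")
      case True
      then show ?thesis
        using y eval[OF y(1) True] by (auto simp: V_def)
    next
      case False
      then show ?thesis
        using that coloc_closed[OF y(1) that] by (simp add: J_def)
    qed
    then have "y \<in> Pi\<^sub>E (carrier G) B"
      using y(1) by (auto simp: topspace_coloc PiE_iff)
    then show ?thesis
      using B(4) y(1) D(2) by blast
  qed
  ultimately show ?thesis
    using g by blast
qed

text \<open>Compactness leaves finitely many neighbourhoods, each read off at its own coordinate; a
  common denominator replaces these coordinates by a single one.\<close>

lemma cover_refined_by_pullback:
  assumes W: "open_cover L \<W>" and nonempty: "topspace L \<noteq> {}"
  shows "\<exists>g\<in>carrier G. \<exists>\<U>. open_cover K \<U> \<and> (\<forall>U\<in>\<U>. \<exists>W\<in>\<W>. \<forall>x\<in>topspace L. x g \<in> U \<longrightarrow> x \<in> W)"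
proof -
  have "\<forall>x\<in>topspace L. \<exists>W g V. W \<in> \<W> \<and> g \<in> carrier G \<and> openin K V \<and> x g \<in> V \<and>
      (\<forall>y\<in>topspace L. y g \<in> V \<longrightarrow> y \<in> W)"
  proof
    fix x assume "x \<in> topspace L"
    then obtain W where "W \<in> \<W>" "x \<in> W" "openin L W"
      using W by (auto simp: open_cover_def)
    then show "\<exists>W g V. W \<in> \<W> \<and> g \<in> carrier G \<and> openin K V \<and> x g \<in> V \<and>
      (\<forall>y\<in>topspace L. y g \<in> V \<longrightarrow> y \<in> W)"
      using basic_neighbourhood by meson
  qed
  then obtain w g V where wgV: "\<And>x. x \<in> topspace L \<Longrightarrow> w x \<in> \<W> \<and> g x \<in> carrier G \<and> openin K (V x) \<and>
      x (g x) \<in> V x \<and> (\<forall>y\<in>topspace L. y (g x) \<in> V x \<longrightarrow> y \<in> w x)"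
    by metis
  define P where "P = (\<lambda>x. {y \<in> topspace L. y (g x) \<in> V x})"
  have "\<exists>\<F>. finite \<F> \<and> \<F> \<subseteq> P ` topspace L \<and> topspace L \<subseteq> \<Union>\<F>"
  proof (rule compact_coloc[unfolded compact_space_alt, rule_format], intro conjI ballI)
    fix U assume "U \<in> P ` topspace L"
    then show "openin L U"
      using wgV by (auto simp: P_def intro!: openin_continuous_map_preimage[OF continuous_eval])
  next
    show "topspace L \<subseteq> \<Union>(P ` topspace L)"
      using wgV by (auto simp: P_def)
  qed
  then obtain X where X: "X \<subseteq> topspace L" "finite X" "topspace L \<subseteq> \<Union>(P ` X)"
    using finite_subset_image by metis
  have "finite (g ` X)" "g ` X \<subseteq> carrier G"
    using X wgV by auto
  then obtain s where s: "s \<in> carrier S" "\<forall>h\<in>g ` X. \<exists>t\<in>carrier S. h = inv\<^bsub>G\<^esub> (\<iota> s) \<otimes>\<^bsub>G\<^esub> \<iota> t"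
    using common_denominator by blast
  then have "\<forall>x\<in>X. \<exists>t. t \<in> carrier S \<and> g x = inv\<^bsub>G\<^esub> (\<iota> s) \<otimes>\<^bsub>G\<^esub> \<iota> t"
    by blast
  from bchoice[OF this] obtain t where t: "\<And>x. x \<in> X \<Longrightarrow> t x \<in> carrier S \<and> g x = inv\<^bsub>G\<^esub> (\<iota> s) \<otimes>\<^bsub>G\<^esub> \<iota> (t x)"
    by blast
  let ?g = "inv\<^bsub>G\<^esub> (\<iota> s)"
  have g: "?g \<in> carrier G"
    using s(1) by simp
  have eval: "y (g x) = \<rho> (t x) (y ?g)" if "y \<in> topspace L" "x \<in> X" for y x
    using coloc_compat[OF that(1) g, of "t x"] t[OF that(2)] by simp
  define U where "U = (\<lambda>x. {z \<in> topspace K. \<rho> (t x) z \<in> V x})"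
  \<comment> \<open>The sets \<open>U x\<close> need only cover the core. Its complement completes
    them to a cover of \<open>K\<close> and contains no coordinate of a thread.\<close>
  define \<U> where "\<U> = insert (topspace K - core) (U ` X)"
  have "open_cover K \<U>"
    unfolding open_cover_def
  proof (intro conjI ballI)
    fix O' assume "O' \<in> \<U>"
    then show "openin K O'"
      using t X wgV closedin_core
      by (auto simp: \<U>_def U_def intro!: openin_continuous_map_preimage[OF continuous_act])
  next
    have "core \<subseteq> \<Union>(U ` X)"
    proof
      fix z assume z: "z \<in> core"
      then obtain y where y: "y \<in> topspace L" "y \<one>\<^bsub>G\<^esub> = z"
        using projection_onto_core by blast
      \<comment> \<open>Shifting the thread by \<open>\<iota> s\<close> moves the value
        \<open>z\<close> from the identity to the coordinate \<open>?g\<close>.\<close>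
      define y' where "y' = ore_coloc_action G (\<iota> s) y"
      have y': "y' \<in> topspace L" "y' ?g = z"
        using y s(1) g by (auto simp: y'_def coloc_action_closed coloc_action_apply)
      then obtain x where x: "x \<in> X" "y' (g x) \<in> V x"
        using X(3) by (auto simp: P_def)
      then show "z \<in> \<Union>(U ` X)"
        using eval[OF y'(1) x(1)] y' z core_subset by (auto simp: U_def)
    qed
    then show "\<Union>\<U> = topspace K"
      by (auto simp: \<U>_def U_def)
  qed
  moreover have "\<exists>W\<in>\<W>. \<forall>y\<in>topspace L. y ?g \<in> O' \<longrightarrow> y \<in> W" if "O' \<in> \<U>" for O'
  proof (cases "O' \<in> U ` X")
    case True
    then obtain x where x: "x \<in> X" "O' = U x"
      by blast
    then have "\<forall>y\<in>topspace L. y ?g \<in> O' \<longrightarrow> y \<in> w x"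
      using X(1) wgV[of x] eval by (auto simp: U_def)
    then show ?thesis
      using x(1) X(1) wgV by blast
  next
    case False
    obtain W where "W \<in> \<W>"
      using nonempty W unfolding open_cover_def by (metis Sup_empty ex_in_conv)
    moreover have "y ?g \<in> core" if "y \<in> topspace L" for y
      using that g by (auto simp: ore_coloc_space_def)
    ultimately show ?thesis
      using False that by (auto simp: \<U>_def)
  qed
  ultimately show ?thesis
    using g by blast
qed

text \<open>Evaluation at \<open>g\<close> is the action of \<open>g\<close> followed by evaluation
  at the identity, so the refinement compares \<W> over \<open>F\<close> with the pulled-back cover
  over \<open>F #> g\<close>, again a Foelner net.\<close>

lemma cover_entropy_le_pullback:
  assumes W: "open_cover L \<W>" and nonempty: "topspace L \<noteq> {}" and \<Phi>: "right_folner G \<Phi>"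
  shows "\<exists>\<U>. open_cover K \<U> \<and> cover_entropy G L (ore_coloc_action G) \<W>
    \<le> cover_entropy G L (ore_coloc_action G) (pullback ` \<U>)"
proof -
  interpret coloc: compact_action G L "ore_coloc_action G"
    by (rule compact_action_coloc)
  obtain g \<U> where g: "g \<in> carrier G" and U: "open_cover K \<U>"
    and refine: "\<forall>U\<in>\<U>. \<exists>W\<in>\<W>. \<forall>x\<in>topspace L. x g \<in> U \<longrightarrow> x \<in> W"
    using cover_refined_by_pullback[OF W nonempty] by blast
  have "\<forall>P\<in>pullback ` \<U>. \<exists>W\<in>\<W>. \<forall>x\<in>topspace L. ore_coloc_action G g x \<in> P \<longrightarrow> x \<in> W"
  proof
    fix P assume "P \<in> pullback ` \<U>"
    then obtain U where U': "U \<in> \<U>" "P = pullback U"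
      by blast
    have "x g \<in> U" if "ore_coloc_action G g x \<in> P" for x
      using that g unfolding U'(2) by (simp add: pullback_def coloc_action_apply)
    then show "\<exists>W\<in>\<W>. \<forall>x\<in>topspace L. ore_coloc_action G g x \<in> P \<longrightarrow> x \<in> W"
      using bspec[OF refine U'(1)] by meson
  qed
  then obtain r where r: "\<And>P. P \<in> pullback ` \<U> \<Longrightarrow>
      r P \<in> \<W> \<and> (\<forall>x\<in>topspace L. ore_coloc_action G g x \<in> P \<longrightarrow> x \<in> r P)"
    by metis
  have "cover_entropy G L (ore_coloc_action G) \<W>
      \<le> cover_entropy G L (ore_coloc_action G) (pullback ` \<U>)"
  proof (rule cover_entropy_le_along[OF compact_action_coloc compact_action_coloc W open_cover_pullback[OF U]])
    show "right_folner G (filtermap (\<lambda>F. F) \<Phi>)"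
      using \<Phi> by (simp add: filtermap_ident)
    show "right_folner G (filtermap (\<lambda>F. F #>\<^bsub>G\<^esub> g) \<Phi>)"
      by (rule G.right_folner_right_translate[OF \<Phi> g])
    have "\<forall>\<^sub>F F in \<Phi>. finite F \<and> F \<noteq> {} \<and> F \<subseteq> carrier G"
      using \<Phi> by (simp add: right_folner_def)
    then show "\<forall>\<^sub>F F in \<Phi>. card F = card (F #>\<^bsub>G\<^esub> g) \<and>
      cover_number L (joined_cover L (ore_coloc_action G) \<W> F)
        \<le> cover_number L (joined_cover L (ore_coloc_action G) (pullback ` \<U>) (F #>\<^bsub>G\<^esub> g))"
    proof eventually_elim
      case (elim F)
      have Fg: "finite (F #>\<^bsub>G\<^esub> g)" "F #>\<^bsub>G\<^esub> g \<subseteq> carrier G" "F #>\<^bsub>G\<^esub> g \<noteq> {}"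
        using elim g by (auto simp: r_coset_image)
      have "cover_number L (joined_cover L (ore_coloc_action G) \<W> F)
        \<le> cover_number L (joined_cover L (ore_coloc_action G) (pullback ` \<U>) (F #>\<^bsub>G\<^esub> g))"
      proof (rule coloc.cover_number_joined_mono_compact[OF open_cover_pullback[OF U] Fg,
            where \<psi> = "\<lambda>u f. r (u (f \<otimes>\<^bsub>G\<^esub> g))"])
        define \<psi> where "\<psi> = (\<lambda>u f. r (u (f \<otimes>\<^bsub>G\<^esub> g)) :: ('g \<Rightarrow> 'k) set)"
        fix A assume A: "covering_words L (ore_coloc_action G) (pullback ` \<U>) (F #>\<^bsub>G\<^esub> g) A"
        have word: "u (f \<otimes>\<^bsub>G\<^esub> g) \<in> pullback ` \<U>" if "u \<in> A" "f \<in> F" for u f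
          using A that by (auto simp: covering_words_def r_coset_image)
        show "covering_words L (ore_coloc_action G) \<W> F ((\<lambda>u f. r (u (f \<otimes>\<^bsub>G\<^esub> g))) ` A)"
          unfolding \<psi>_def[symmetric] covering_words_def
        proof (intro conjI ballI)
          show "finite (\<psi> ` A)"
            using A by (simp add: covering_words_def)
          show "\<psi> ` A \<subseteq> F \<rightarrow> \<W>"
            using r[OF word] by (auto simp: \<psi>_def)
          fix x assume x: "x \<in> topspace L"
          then obtain u where u: "u \<in> A" "\<forall>h\<in>F #>\<^bsub>G\<^esub> g. ore_coloc_action G h x \<in> u h"
            using A by (auto simp: covering_words_def)
          have "ore_coloc_action G f x \<in> \<psi> u f" if f: "f \<in> F" for f
          proof -
            have fG: "f \<in> carrier G"
              using f elim by blast
            have "ore_coloc_action G (f \<otimes>\<^bsub>G\<^esub> g) x \<in> u (f \<otimes>\<^bsub>G\<^esub> g)"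
              using u(2) f by (auto simp: r_coset_image)
            then show ?thesis
              using r[OF word[OF u(1) f]] coloc.act_mult[OF fG g x] coloc.act_closed[OF fG x] by (simp add: \<psi>_def)
          qed
          then show "\<exists>v\<in>\<psi> ` A. \<forall>f\<in>F. ore_coloc_action G f x \<in> v f"
            using u(1) by blast
        qed
      qed (use elim in auto)
      then show ?case
        using elim G.card_r_coset[OF g, of F] by simp
    qed
  qed
  then show ?thesis
    using U by blast
qed

end

theorem theorem3p15:
  fixes S :: "('s, 'b) monoid_scheme"
    and G :: "('g, 'c) monoid_scheme"
    and \<iota> :: "'s \<Rightarrow> 'g"
    and K :: "'k topology"
    and \<rho> :: "'s \<Rightarrow> 'k \<Rightarrow> 'k"
  assumes "monoid_cancel S"
    and "right_amenable S"
    and "group_of_left_fractions S G \<iota>"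
    and "compact_space K"
    and "Hausdorff_space K"
    and "right_action S K \<rho>"
  shows "top_entropy S K \<rho> = top_entropy G (ore_coloc_space S G \<iota> K \<rho>) (ore_coloc_action G)"
proof -
  interpret S: monoid_cancel S by fact
  interpret G: group G
    using assms(3) by (simp add: group_of_left_fractions_def)
  interpret ore_colocalization S G \<iota> K \<rho>
    by unfold_locales fact+
  interpret coloc: compact_action G L "ore_coloc_action G"
    by (rule compact_action_coloc)
  obtain \<Phi> where \<Phi>: "right_folner S \<Phi>"
    using assms(2) by (auto simp: right_amenable_def)
  note \<Phi>G = right_folner_embedding[OF \<Phi>]
  show ?thesis
    unfolding top_entropy_def
  proof (intro antisym SUP_least; clarify)
    fix \<U> assume U: "open_cover K \<U>"
    show "ereal (cover_entropy S K \<rho> \<U>)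
        \<le> (SUP \<W>\<in>{\<W>. open_cover L \<W>}. ereal (cover_entropy G L (ore_coloc_action G) \<W>))"
      using open_cover_pullback[OF U] by (intro SUP_upper2) (auto simp: cover_entropy_pullback[OF U \<Phi>])
  next
    fix \<W> assume W: "open_cover L \<W>"
    have "\<exists>\<U>. open_cover K \<U> \<and> cover_entropy G L (ore_coloc_action G) \<W> \<le> cover_entropy S K \<rho> \<U>"
    \<comment> \<open>The refinement by pullbacks needs a point of \<open>L\<close>; on the empty
      space the entropy is 0 and any cover of \<open>K\<close> bounds it.\<close>
    proof (cases "topspace L = {}")
      case True
      have "open_cover K {topspace K}"
        by (simp add: open_cover_def)
      then show ?thesis
        using coloc.cover_entropy_empty_space[OF W \<Phi>G True] cover_entropy_nonneg[OF _ \<Phi>] by auto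
    next
      case False
      then show ?thesis
        using cover_entropy_le_pullback[OF W _ \<Phi>G] cover_entropy_pullback[OF _ \<Phi>] by auto
    qed
    then show "ereal (cover_entropy G L (ore_coloc_action G) \<W>)
        \<le> (SUP \<U>\<in>{\<U>. open_cover K \<U>}. ereal (cover_entropy S K \<rho> \<U>))"
      by (auto intro!: SUP_upper2)
  qed
qed

end
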